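(* Let $S$ and $\hat S$ be the exact and hybrid data augmentation kernels on $\mathsf X_1$ (defined in the context). Let $\gamma:\mathsf X_2\to[0,1]$ be a measurable function such that $\|Q_{1,z}\|_{\Pi_{1,z}}\le\gamma(z)$ for $M_2$-a.e. $z\in\mathsf X_2$. For each positive integer $t$, let $\alpha_t\in[0,1]$ be such that $\int_{\mathsf X_2}\gamma(z)^t\,\Pi_{2,y}(dz)\le\alpha_t$ for $M_1$-a.e. $y\in\mathsf X_1$. Then, if $t$ is even, or if $Q_{1,z}$ is positive semi-definite for $M_2$-a.e. $z\in\mathsf X_2$, $$t\,(1-\|\hat S\|_{M_1})\ge 1-\|\hat S\|_{M_1}^t\ge 1-\|S\|_{M_1}-\alpha_t.$$
   Context: $L^2$ conventions. For a probability space $(\mathsf Y,\mathcal F,\omega)$, $L^2(\omega)$ is the real Hilbert space of square-integrable functions (modulo a.e. equality) with inner product $\langle f,g\rangle_\omega=\int fg\,d\omega$ and norm $\|\cdot\|_\omega$; $L_0^2(\omega)=\{f\in L^2(\omega):\int f\,d\omega=0\}$. A Markov transition kernel (Mtk) $K$ on $\mathsf Y$ reversible with respect to $\omega$ acts as a self-adjoint operator on $L_0^2(\omega)$ by $Kf(y)=\int K(y,dy')f(y')$; $\|K\|_\omega\in[0,1]$ is its operator norm on $L_0^2(\omega)$, and $K$ is positive semi-definite if $\langle f,Kf\rangle_\omega\ge0$ for all $f\in L_0^2(\omega)$. Data augmentation setting. $\mathsf X_1,\mathsf X_2$ are Polish spaces with Borel $\sigma$-algebras $\mathcal B_1,\mathcal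 B_2$, and $\Pi$ is a probability measure on $\mathsf X_1\times\mathsf X_2$. For $(X_1,X_2)\sim\Pi$, $M_1,M_2$ are the marginal distributions of $X_1,X_2$; $\Pi_{2,y}$ is the conditional distribution of $X_2$ given $X_1=y$; $\Pi_{1,z}$ is the conditional distribution of $X_1$ given $X_2=z$. For each $z\in\mathsf X_2$, $Q_{1,z}:\mathsf X_1\times\mathcal B_1\to[0,1]$ is an Mtk reversible with respect to $\Pi_{1,z}$, and $(y,z)\mapsto Q_{1,z}(y,A)$ is measurable for every $A\in\mathcal B_1$. Define $$S(y,dy')=\int_{\mathsf X_2}\Pi_{2,y}(dz)\,\Pi_{1,z}(dy'),\qquad \hat S(y,dy')=\int_{\mathsf X_2}\Pi_{2,y}(dz)\,Q_{1,z}(y,dy').$$ Both are reversible with respect to $M_1$. *)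

theory Defs
  imports "HOL-Probability.Probability"
begin

text \<open>
  Elements of \<open>L\<^sup>2(\<omega>)\<close> are represented by functions. A kernel that is reversible with respect
  to \<open>\<omega>\<close> leaves \<open>\<omega>\<close> invariant, so its operator respects \<open>\<omega>\<close>-a.e. equality, and the value \<open>0\<close>
  of \<open>kernel_op K f\<close> at points where \<open>f\<close> is not integrable matters only on a null set.
\<close>

definition L2_0 :: "'a measure \<Rightarrow> ('a \<Rightarrow> real) set" where
  "L2_0 \<omega> = {f \<in> borel_measurable \<omega>.
     integrable \<omega> (\<lambda>x. (f x)\<^sup>2) \<and> (\<integral>x. f x \<partial>\<omega>) = 0}"

definition L2_inner :: "'a measure \<Rightarrow> ('a \<Rightarrow> real) \<Rightarrow> ('a \<Rightarrow> real) \<Rightarrow> real" where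
  "L2_inner \<omega> f g = (\<integral>x. f x * g x \<partial>\<omega>)"

definition L2_nrm :: "'a measure \<Rightarrow> ('a \<Rightarrow> real) \<Rightarrow> real" where
  "L2_nrm \<omega> f = sqrt (L2_inner \<omega> f f)"

definition kernel_op :: "('a \<Rightarrow> 'a measure) \<Rightarrow> ('a \<Rightarrow> real) \<Rightarrow> 'a \<Rightarrow> real" where
  "kernel_op K f = (\<lambda>y. \<integral>y'. f y' \<partial>K y)"

definition reversible :: "'a measure \<Rightarrow> ('a \<Rightarrow> 'a measure) \<Rightarrow> bool" where
  "reversible \<omega> K \<longleftrightarrow> (\<forall>A\<in>sets \<omega>. \<forall>B\<in>sets \<omega>.
     (\<integral>\<^sup>+y\<in>A. emeasure (K y) B \<partial>\<omega>) = (\<integral>\<^sup>+y\<in>B. emeasure (K y) A \<partial>\<omega>))"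

text \<open>
  As in \<open>onorm\<close>, with \<open>0 / 0 = 0\<close>. For a reversible Markov transition kernel the quotients
  lie in \<open>[0, 1]\<close> (Jensen's inequality), so the supremum is a genuine one.
\<close>

definition kernel_norm :: "'a measure \<Rightarrow> ('a \<Rightarrow> 'a measure) \<Rightarrow> real" where
  "kernel_norm \<omega> K = (SUP f\<in>L2_0 \<omega>. L2_nrm \<omega> (kernel_op K f) / L2_nrm \<omega> f)"

definition kernel_psd :: "'a measure \<Rightarrow> ('a \<Rightarrow> 'a measure) \<Rightarrow> bool" where
  "kernel_psd \<omega> K \<longleftrightarrow> (\<forall>f\<in>L2_0 \<omega>. 0 \<le> L2_inner \<omega> f (kernel_op K f))"

text \<open>
  \<open>cond_distr P Y X \<kappa>\<close>: \<open>\<kappa>\<close> is a (version of the) regular conditional distribution of \<open>Y\<close> given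
  \<open>X\<close> under \<open>P\<close>.
\<close>

definition cond_distr ::
  "'c measure \<Rightarrow> ('c \<Rightarrow> 'b::topological_space) \<Rightarrow> ('c \<Rightarrow> 'a::topological_space)
    \<Rightarrow> ('a \<Rightarrow> 'b measure) \<Rightarrow> bool" where
  "cond_distr P Y X \<kappa> \<longleftrightarrow>
     \<kappa> \<in> borel \<rightarrow>\<^sub>M prob_algebra borel \<and>
     (\<forall>A\<in>sets borel. \<forall>B\<in>sets borel.
        emeasure P {w \<in> space P. X w \<in> A \<and> Y w \<in> B}
          = (\<integral>\<^sup>+x\<in>A. emeasure (\<kappa> x) B \<partial>distr P borel X))"

definition exact_da :: "('a \<Rightarrow> 'b measure) \<Rightarrow> ('b \<Rightarrow> 'a measure) \<Rightarrow> 'a \<Rightarrow> 'a measure" where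
  "exact_da P2 P1 y = P2 y \<bind> P1"

definition hybrid_da ::
  "('a \<Rightarrow> 'b measure) \<Rightarrow> ('b \<Rightarrow> 'a \<Rightarrow> 'a measure) \<Rightarrow> 'a \<Rightarrow> 'a measure" where
  "hybrid_da P2 Q y = P2 y \<bind> (\<lambda>z. Q z y)"

end

theory Submission
  imports Defs
begin

text \<open>
  For unit vectors \<open>f\<close>, \<open>g\<close> of \<open>L\<^sup>2\<^sub>0(M\<^sub>1)\<close>, the form \<open>\<langle>g, S_hat f\<rangle>\<close> is the integral over \<open>z\<close> of
  \<open>\<langle>g, Q\<^sub>z f\<rangle>\<close> in \<open>L\<^sup>2(\<Pi>\<^sub>1\<^sub>,\<^sub>z)\<close>. Splitting \<open>f\<close> and \<open>g\<close> into conditional mean and remainder and using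
  \<open>2ab \<le> a\<^sup>2 + b\<^sup>2\<close> bounds this by the integral of \<open>A + \<gamma> V\<close>, where \<open>A\<close> averages the squared
  conditional means and \<open>V\<close> the conditional variances of \<open>f\<close> and \<open>g\<close>. Since \<open>A + V\<close> integrates to \<open>1\<close>,
  Jensen's inequality bounds the \<open>t\<close>-th power by the integral of \<open>A + \<gamma>\<^sup>t V\<close>. The integral of \<open>A\<close> is
  the mean of \<open>\<langle>f, S f\<rangle>\<close> and \<open>\<langle>g, S g\<rangle>\<close>, and the rest is at most \<open>\<alpha>\<^sub>t\<close>. With \<open>g\<close> proportional to
  \<open>S_hat f\<close> this becomes a bound on the operator norm.
\<close>

subsection \<open>Kernels and square-integrable functions\<close>

text \<open>The convex function \<open>u ^ Suc n\<close> lies above its tangent at \<open>x\<close>.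
  This gives Jensen's inequality for the weights \<open>A\<close> and \<open>V\<close>, and at
  \<open>x = 1\<close> Bernoulli's inequality for the final estimate.\<close>

lemma power_tangent_le:
  fixes u x :: real
  assumes "0 \<le> u" "0 \<le> x"
  shows "real (Suc n) * x ^ n * u \<le> u ^ Suc n + real n * x ^ Suc n"
proof (induction n)
  case 0
  then show ?case by simp
next
  case (Suc n)
  have "u * (real (Suc n) * x ^ n * u) \<le> u * (u ^ Suc n + real n * x ^ Suc n)"
    using Suc assms by (intro mult_left_mono) auto
  \<comment> \<open>The square bounds \<open>x ^ n * u\<^sup>2\<close> below by
    \<open>2 * x ^ (n + 1) * u - x ^ (n + 2)\<close>, which turns the induction hypothesis times
    \<open>u\<close> into the next tangent inequality.\<close>
  moreover have "0 \<le> real (Suc n) * x ^ n * (u - x)\<^sup>2"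
    using assms by simp
  ultimately show ?case
    by (simp add: algebra_simps power2_eq_square)
qed

lemma prob_algebra_cong: "sets M = sets N \<Longrightarrow> prob_algebra M = prob_algebra N"
  unfolding prob_algebra_def by (simp cong: subprob_algebra_cong)

text \<open>Measurable rectangles are closed under intersection and generate the product
  sigma-algebra, and the whole space is one of them with finite mass. This identifies the joint law
  with its two disintegrations.\<close>

lemma prob_space_eqI_rectangles:
  assumes M: "prob_space M" "sets M = sets (A \<Otimes>\<^sub>M B)"
    and N: "prob_space N" "sets N = sets (A \<Otimes>\<^sub>M B)"
    and eq: "\<And>X Y. X \<in> sets A \<Longrightarrow> Y \<in> sets B \<Longrightarrow> emeasure M (X \<times> Y) = emeasure N (X \<times> Y)"
  shows "M = N"
proof (rule measure_eqI_generator_eq[where A = "\<lambda>i. space A \<times> space B"])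
  show "Int_stable {X \<times> Y |X Y. X \<in> sets A \<and> Y \<in> sets B}"
    by (rule Int_stable_pair_measure_generator)
  show "{X \<times> Y |X Y. X \<in> sets A \<and> Y \<in> sets B} \<subseteq> Pow (space A \<times> space B)"
    by (auto dest: sets.sets_into_space)
  show "emeasure M (space A \<times> space B) \<noteq> \<infinity>" for i :: nat
    using M(1) by (simp add: prob_space_def finite_measure.emeasure_finite)
qed (use M N eq in \<open>auto simp: sets_pair_measure\<close>)

text \<open>Fubini for a measure composed with a kernel. Nonnegative functions are handled by
  extended integrals, the general case by positive and negative parts.\<close>

lemma
  fixes h :: "'b \<Rightarrow> real"
  assumes K: "K \<in> M \<rightarrow>\<^sub>M subprob_algebra N"
    and h: "integrable (M \<bind> K) h" "h \<in> borel_measurable N"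
  shows AE_integrable_bind: "AE x in M. integrable (K x) h"
    and integrable_integral_bind: "integrable M (\<lambda>x. \<integral>y. h y \<partial>K x)"
    and integral_bind_integrable: "(\<integral>y. h y \<partial>(M \<bind> K)) = (\<integral>x. \<integral>y. h y \<partial>K x \<partial>M)"
proof -
  have *: "(AE x in M. integrable (K x) g) \<and> integrable M (\<lambda>x. \<integral>y. g y \<partial>K x)
      \<and> (\<integral>y. g y \<partial>(M \<bind> K)) = (\<integral>x. \<integral>y. g y \<partial>K x \<partial>M)"
    if g: "integrable (M \<bind> K) g" "g \<in> borel_measurable N" and pos: "\<And>y. 0 \<le> g y"
    for g :: "'b \<Rightarrow> real"
  proof -
    have sets_K: "sets (K x) = sets N" if "x \<in> space M" for x
      using K that by (rule sets_kernel)
    have gK: "g \<in> borel_measurable (K x)" if "x \<in> space M" for x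
      using g(2) sets_K[OF that] by (simp cong: measurable_cong_sets)
    have meas: "(\<lambda>x. \<integral>\<^sup>+y. g y \<partial>K x) \<in> borel_measurable M"
      using g(2) by (intro measurable_compose[OF K] nn_integral_measurable_subprob_algebra) auto
    have meas': "(\<lambda>x. \<integral>y. g y \<partial>K x) \<in> borel_measurable M"
      using g(2) by (intro measurable_compose[OF K] integral_measurable_subprob_algebra) auto
    have eq: "(\<integral>\<^sup>+x. g x \<partial>(M \<bind> K)) = (\<integral>\<^sup>+x. \<integral>\<^sup>+y. g y \<partial>K x \<partial>M)"
      using g(2) by (intro nn_integral_bind[OF _ K]) auto
    have fin: "(\<integral>\<^sup>+x. g x \<partial>(M \<bind> K)) < \<infinity>"
      using g(1) pos by (simp add: integrable_iff_bounded)
    \<comment> \<open>A finite iterated integral allows an infinite inner integral only on a null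
      set.\<close>
    have "AE x in M. (\<integral>\<^sup>+y. g y \<partial>K x) \<noteq> \<infinity>"
      using fin by (intro nn_integral_PInf_AE meas) (simp add: eq)
    then have int: "AE x in M. integrable (K x) g"
      using AE_space
    proof eventually_elim
      fix x assume "(\<integral>\<^sup>+y. g y \<partial>K x) \<noteq> \<infinity>" and "x \<in> space M"
      then show "integrable (K x) g"
        using pos gK by (intro integrableI_nonneg) (auto simp: less_top)
    qed
    have eq2: "(\<integral>\<^sup>+x. \<integral>\<^sup>+y. g y \<partial>K x \<partial>M) = (\<integral>\<^sup>+x. ennreal (\<integral>y. g y \<partial>K x) \<partial>M)"
      using int pos by (intro nn_integral_cong_AE) (auto elim!: eventually_mono intro: nn_integral_eq_integral)
    have int2: "integrable M (\<lambda>x. \<integral>y. g y \<partial>K x)"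
      using meas' fin pos eq eq2 by (intro integrableI_nonneg) auto
    have "ennreal (\<integral>y. g y \<partial>(M \<bind> K)) = ennreal (\<integral>x. \<integral>y. g y \<partial>K x \<partial>M)"
      using eq eq2 pos nn_integral_eq_integral[OF g(1)] nn_integral_eq_integral[OF int2] by simp
    then show ?thesis
      using int int2 pos by simp
  qed
  define p n where "p = (\<lambda>y. max (h y) 0)" and "n = (\<lambda>y. max (- h y) 0)"
  have h_eq: "h = (\<lambda>y. p y - n y)"
    by (auto simp: p_def n_def fun_eq_iff)
  have p: "(AE x in M. integrable (K x) p) \<and> integrable M (\<lambda>x. \<integral>y. p y \<partial>K x)
      \<and> (\<integral>y. p y \<partial>(M \<bind> K)) = (\<integral>x. \<integral>y. p y \<partial>K x \<partial>M)"
    using h by (intro *) (auto simp: p_def)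
  have n: "(AE x in M. integrable (K x) n) \<and> integrable M (\<lambda>x. \<integral>y. n y \<partial>K x)
      \<and> (\<integral>y. n y \<partial>(M \<bind> K)) = (\<integral>x. \<integral>y. n y \<partial>K x \<partial>M)"
    using h by (intro *) (auto simp: n_def)
  have int: "integrable (M \<bind> K) p" "integrable (M \<bind> K) n"
    using h by (auto simp: p_def n_def)
  show AE: "AE x in M. integrable (K x) h"
    using p n unfolding h_eq by (auto elim: eventually_elim2)
  have meas_h: "(\<lambda>x. \<integral>y. h y \<partial>K x) \<in> borel_measurable M"
    using h(2) by (intro measurable_compose[OF K] integral_measurable_subprob_algebra) auto
  \<comment> \<open>Subtracting the inner integrals is justified where both parts are integrable,
    hence almost everywhere.\<close>
  have cong: "AE x in M. (\<integral>y. p y \<partial>K x) - (\<integral>y. n y \<partial>K x) = (\<integral>y. h y \<partial>K x)"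
    using p[THEN conjunct1] n[THEN conjunct1] unfolding h_eq by eventually_elim simp
  have diff: "integrable M (\<lambda>x. (\<integral>y. p y \<partial>K x) - (\<integral>y. n y \<partial>K x))"
    using p n by auto
  show "integrable M (\<lambda>x. \<integral>y. h y \<partial>K x)"
    by (rule Bochner_Integration.integrable_cong_AE_imp[OF diff meas_h]) (use cong in auto)
  have "(\<integral>x. \<integral>y. h y \<partial>K x \<partial>M) = (\<integral>x. (\<integral>y. p y \<partial>K x) - (\<integral>y. n y \<partial>K x) \<partial>M)"
    using diff meas_h cong by (intro integral_cong_AE) (auto elim: eventually_mono)
  also have "\<dots> = (\<integral>y. p y \<partial>(M \<bind> K)) - (\<integral>y. n y \<partial>(M \<bind> K))"
    using p n by simp
  also have "\<dots> = (\<integral>y. h y \<partial>(M \<bind> K))"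
    using int unfolding h_eq by simp
  finally show "(\<integral>y. h y \<partial>(M \<bind> K)) = (\<integral>x. \<integral>y. h y \<partial>K x \<partial>M)" ..
qed

text \<open>There is no mean-zero condition, because a function centred under \<open>M1\<close> is
  in general not centred under the conditional laws \<open>P1 z\<close>.\<close>

definition L2 :: "'a measure \<Rightarrow> ('a \<Rightarrow> real) set" where
  "L2 \<omega> = {f \<in> borel_measurable \<omega>. integrable \<omega> (\<lambda>x. (f x)\<^sup>2)}"

lemma L2D: "f \<in> L2 \<omega> \<Longrightarrow> f \<in> borel_measurable \<omega>" "f \<in> L2 \<omega> \<Longrightarrow> integrable \<omega> (\<lambda>x. (f x)\<^sup>2)"
  by (auto simp: L2_def)

lemma L2_0_iff: "f \<in> L2_0 \<omega> \<longleftrightarrow> f \<in> L2 \<omega> \<and> (\<integral>x. f x \<partial>\<omega>) = 0"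
  by (auto simp: L2_0_def L2_def)

lemma L2_cmult: "f \<in> L2 \<omega> \<Longrightarrow> (\<lambda>x. c * f x) \<in> L2 \<omega>"
  by (auto simp: L2_def power_mult_distrib)

lemma abs_mult_le_mean_squares: "\<bar>a * b\<bar> \<le> (a\<^sup>2 + b\<^sup>2) / 2" for a b :: real
  using sum_squares_bound[of "\<bar>a\<bar>" "\<bar>b\<bar>"] by (simp add: abs_mult)

lemma integrable_mult_L2:
  assumes "f \<in> L2 \<omega>" "g \<in> L2 \<omega>"
  shows "integrable \<omega> (\<lambda>x. f x * g x)"
proof (rule Bochner_Integration.integrable_bound)
  show "integrable \<omega> (\<lambda>x. (f x)\<^sup>2 + (g x)\<^sup>2)"
    using assms by (auto simp: L2_def)
  show "(\<lambda>x. f x * g x) \<in> borel_measurable \<omega>"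
    using assms by (auto simp: L2_def)
  show "AE x in \<omega>. norm (f x * g x) \<le> norm ((f x)\<^sup>2 + (g x)\<^sup>2)"
  proof (rule AE_I2)
    fix x show "norm (f x * g x) \<le> norm ((f x)\<^sup>2 + (g x)\<^sup>2)"
      using abs_mult_le_mean_squares[of "f x" "g x"] zero_le_power2[of "f x"] zero_le_power2[of "g x"]
      by (simp add: field_simps)
  qed
qed

lemma L2_add:
  assumes "f \<in> L2 \<omega>" "g \<in> L2 \<omega>"
  shows "(\<lambda>x. f x + g x) \<in> L2 \<omega>"
  using assms integrable_mult_L2[OF assms] by (auto simp: L2_def power2_sum mult.assoc)

lemma L2_nrm_alt: "L2_nrm \<omega> f = sqrt (\<integral>x. (f x)\<^sup>2 \<partial>\<omega>)"
  by (simp add: L2_nrm_def L2_inner_def power2_eq_square)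

lemma L2_nrm_power2: "(L2_nrm \<omega> f)\<^sup>2 = (\<integral>x. (f x)\<^sup>2 \<partial>\<omega>)"
  by (simp add: L2_nrm_alt)

lemma L2_nrm_nonneg: "0 \<le> L2_nrm \<omega> f"
  by (simp add: L2_nrm_alt)

lemma L2_nrm_cmult: "L2_nrm \<omega> (\<lambda>x. c * f x) = \<bar>c\<bar> * L2_nrm \<omega> f"
  by (simp add: L2_nrm_alt power_mult_distrib real_sqrt_mult)

text \<open>The extended-integral version is applied to absolute values; square integrability
  carries it over to real integrals.\<close>

lemma L2_Cauchy_Schwarz:
  assumes "f \<in> L2 \<omega>" "g \<in> L2 \<omega>"
  shows "\<bar>\<integral>x. f x * g x \<partial>\<omega>\<bar> \<le> L2_nrm \<omega> f * L2_nrm \<omega> g"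
proof -
  have int: "integrable \<omega> (\<lambda>x. \<bar>f x * g x\<bar>)"
    using integrable_mult_L2[OF assms] by simp
  have "(\<integral>\<^sup>+x. ennreal \<bar>f x\<bar> * ennreal \<bar>g x\<bar> \<partial>\<omega>)\<^sup>2
      \<le> (\<integral>\<^sup>+x. (ennreal \<bar>f x\<bar>)\<^sup>2 \<partial>\<omega>) * (\<integral>\<^sup>+x. (ennreal \<bar>g x\<bar>)\<^sup>2 \<partial>\<omega>)"
    using assms by (intro Cauchy_Schwarz_nn_integral) (auto simp: L2_def)
  also have "(\<integral>\<^sup>+x. ennreal \<bar>f x\<bar> * ennreal \<bar>g x\<bar> \<partial>\<omega>) = ennreal (\<integral>x. \<bar>f x * g x\<bar> \<partial>\<omega>)"
    using nn_integral_eq_integral[OF int] by (simp add: abs_mult ennreal_mult)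
  also have "(\<integral>\<^sup>+x. (ennreal \<bar>f x\<bar>)\<^sup>2 \<partial>\<omega>) = ennreal (\<integral>x. (f x)\<^sup>2 \<partial>\<omega>)"
    using nn_integral_eq_integral[OF L2D(2)[OF assms(1)]] by (simp add: ennreal_power)
  also have "(\<integral>\<^sup>+x. (ennreal \<bar>g x\<bar>)\<^sup>2 \<partial>\<omega>) = ennreal (\<integral>x. (g x)\<^sup>2 \<partial>\<omega>)"
    using nn_integral_eq_integral[OF L2D(2)[OF assms(2)]] by (simp add: ennreal_power)
  finally have "(\<integral>x. \<bar>f x * g x\<bar> \<partial>\<omega>)\<^sup>2 \<le> (\<integral>x. (f x)\<^sup>2 \<partial>\<omega>) * (\<integral>x. (g x)\<^sup>2 \<partial>\<omega>)"
    by (simp add: ennreal_power flip: ennreal_mult)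
  then have "(\<integral>x. \<bar>f x * g x\<bar> \<partial>\<omega>) \<le> L2_nrm \<omega> f * L2_nrm \<omega> g"
    by (simp add: L2_nrm_alt real_le_rsqrt flip: real_sqrt_mult)
  then show ?thesis
    using integral_abs_bound[of \<omega> "\<lambda>x. f x * g x"] by linarith
qed

context prob_space
begin

lemma L2_const: "(\<lambda>x. c) \<in> L2 M"
  by (auto simp: L2_def)

lemma L2_diff_const: "f \<in> L2 M \<Longrightarrow> (\<lambda>x. f x - c) \<in> L2 M"
  using L2_add[OF _ L2_const[of "- c"]] by simp

lemma L2_integrable: "f \<in> L2 M \<Longrightarrow> integrable M f"
  by (auto simp: L2_def intro: square_integrable_imp_integrable)

lemma L2_nrm_centered:
  assumes "f \<in> L2 M"
  shows "(L2_nrm M (\<lambda>x. f x - expectation f))\<^sup>2 = (\<integral>x. (f x)\<^sup>2 \<partial>M) - (expectation f)\<^sup>2"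
  unfolding L2_nrm_power2
  using variance_eq[OF L2_integrable[OF assms] L2D(2)[OF assms]] by simp

lemma integral_power2_le:
  assumes "f \<in> L2 M"
  shows "(expectation f)\<^sup>2 \<le> (\<integral>x. (f x)\<^sup>2 \<partial>M)"
  using L2_nrm_centered[OF assms] by (metis diff_ge_0_iff_ge zero_le_power2)

end

text \<open>If the square is not integrable, the right side is infinite. In this form the variance
  bound applies under every \<open>Q z y\<close>, before integrability there is known.\<close>

lemma (in prob_space) nn_integral_power2_ge:
  assumes f: "f \<in> borel_measurable M"
  shows "ennreal ((expectation f)\<^sup>2) \<le> (\<integral>\<^sup>+x. ennreal ((f x)\<^sup>2) \<partial>M)"
proof (cases "integrable M (\<lambda>x. (f x)\<^sup>2)")
  case True
  then show ?thesis
    using integral_power2_le[of f] f by (simp add: nn_integral_eq_integral L2_def ennreal_leI)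
next
  case False
  have "(\<integral>\<^sup>+x. ennreal ((f x)\<^sup>2) \<partial>M) = \<infinity>"
  proof (rule ccontr)
    assume "(\<integral>\<^sup>+x. ennreal ((f x)\<^sup>2) \<partial>M) \<noteq> \<infinity>"
    then have "integrable M (\<lambda>x. (f x)\<^sup>2)"
      using f by (intro integrableI_nonneg) (auto simp: less_top)
    then show False
      using False by simp
  qed
  then show ?thesis
    by simp
qed

subsection \<open>Invariant kernels\<close>

text \<open>Invariance makes averaging by \<open>K\<close> preserve integrals. The locale covers
  each \<open>Q z\<close> over \<open>P1 z\<close>, the constant kernel \<open>P1 z\<close>, and the
  hybrid and exact kernels over \<open>M1\<close>.\<close>

locale invariant_kernel = prob_space +
  fixes K
  assumes kernel: "K \<in> M \<rightarrow>\<^sub>M prob_algebra M"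
    and invariant: "M \<bind> K = M"
begin

lemma prob_kernel: "y \<in> space M \<Longrightarrow> prob_space (K y)"
  and sets_K: "y \<in> space M \<Longrightarrow> sets (K y) = sets M"
  using measurable_space[OF kernel] by (auto simp: space_prob_algebra)

lemma integrable_const_K: "y \<in> space M \<Longrightarrow> integrable (K y) (\<lambda>x. c :: real)"
  using prob_space.finite_measure[OF prob_kernel] by (simp add: finite_measure.integrable_const)

lemma kernel_op_measurable: "f \<in> borel_measurable M \<Longrightarrow> kernel_op K f \<in> borel_measurable M"
  unfolding kernel_op_def
  by (intro measurable_compose[OF measurable_prob_algebraD[OF kernel]]
      integral_measurable_subprob_algebra)

lemma
  assumes "integrable M f"
  shows AE_integrable: "AE y in M. integrable (K y) f"
    and integrable_kernel_op: "integrable M (kernel_op K f)"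
    and integral_kernel_op: "(\<integral>y. kernel_op K f y \<partial>M) = (\<integral>y. f y \<partial>M)"
proof -
  have K: "K \<in> M \<rightarrow>\<^sub>M subprob_algebra M"
    by (rule measurable_prob_algebraD[OF kernel])
  have f: "integrable (M \<bind> K) f" "f \<in> borel_measurable M"
    using assms by (auto simp: invariant)
  show "AE y in M. integrable (K y) f"
    by (rule AE_integrable_bind[OF K f])
  show "integrable M (kernel_op K f)"
    unfolding kernel_op_def by (rule integrable_integral_bind[OF K f])
  show "(\<integral>y. kernel_op K f y \<partial>M) = (\<integral>y. f y \<partial>M)"
    unfolding kernel_op_def using integral_bind_integrable[OF K f] by (simp add: invariant)
qed

lemma AE_kernel_L2:
  assumes "f \<in> L2 M"
  shows "AE y in M. f \<in> L2 (K y)"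
  using AE_integrable[OF L2D(2)[OF assms]] AE_space
  by eventually_elim (use sets_K L2D[OF assms] in \<open>auto simp: L2_def cong: measurable_cong_sets\<close>)

text \<open>Jensen's inequality under each probability \<open>K y\<close> bounds the squared average
  by the average of the square; by invariance the latter integrates to the integral of
  \<open>f\<^sup>2\<close>.\<close>

lemma
  assumes f: "f \<in> L2 M"
  shows kernel_op_L2: "kernel_op K f \<in> L2 M"
    and L2_nrm_kernel_op_le: "L2_nrm M (kernel_op K f) \<le> L2_nrm M f"
proof -
  have le: "AE y in M. (kernel_op K f y)\<^sup>2 \<le> kernel_op K (\<lambda>x. (f x)\<^sup>2) y"
    using AE_kernel_L2[OF f] AE_space
    by eventually_elim (auto simp: kernel_op_def intro!: prob_space.integral_power2_le prob_kernel)
  have meas: "kernel_op K f \<in> borel_measurable M"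
    using f by (intro kernel_op_measurable) (auto simp: L2_def)
  have int: "integrable M (kernel_op K (\<lambda>x. (f x)\<^sup>2))"
    using f by (intro integrable_kernel_op) (auto simp: L2_def)
  have int2: "integrable M (\<lambda>y. (kernel_op K f y)\<^sup>2)"
    using int
  proof (rule Bochner_Integration.integrable_bound)
    show "AE y in M. norm ((kernel_op K f y)\<^sup>2) \<le> norm (kernel_op K (\<lambda>x. (f x)\<^sup>2) y)"
      using le by eventually_elim auto
  qed (use meas in auto)
  then show "kernel_op K f \<in> L2 M"
    using meas by (auto simp: L2_def)
  have "(\<integral>y. (kernel_op K f y)\<^sup>2 \<partial>M) \<le> (\<integral>y. kernel_op K (\<lambda>x. (f x)\<^sup>2) y \<partial>M)"
    using int2 int le by (rule integral_mono_AE)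
  also have "\<dots> = (\<integral>y. (f y)\<^sup>2 \<partial>M)"
    using f by (intro integral_kernel_op) (auto simp: L2_def)
  finally show "L2_nrm M (kernel_op K f) \<le> L2_nrm M f"
    by (simp add: L2_nrm_alt)
qed

lemma kernel_op_L2_0: "f \<in> L2_0 M \<Longrightarrow> kernel_op K f \<in> L2_0 M"
  by (simp add: L2_0_iff kernel_op_L2 integral_kernel_op L2_integrable)

text \<open>This makes \<open>kernel_norm\<close> the supremum of a set that is bounded above. A
  function of norm zero contributes \<open>0\<close>, as \<open>x / 0 = 0\<close>.\<close>

lemma kernel_quotient_le_1:
  "f \<in> L2_0 M \<Longrightarrow> L2_nrm M (kernel_op K f) / L2_nrm M f \<le> 1"
  using L2_nrm_kernel_op_le[of f] L2_nrm_nonneg[of M f]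
  by (cases "L2_nrm M f = 0") (auto simp: L2_0_iff divide_le_eq_1)

lemma kernel_quotient_le_kernel_norm:
  assumes "f \<in> L2_0 M"
  shows "L2_nrm M (kernel_op K f) / L2_nrm M f \<le> kernel_norm M K"
  unfolding kernel_norm_def using assms kernel_quotient_le_1
  by (intro cSUP_upper bdd_aboveI2[where M = 1])

lemma zero_in_L2_0: "(\<lambda>x. 0) \<in> L2_0 M"
  by (simp add: L2_0_iff L2_const)

lemma kernel_norm_nonneg: "0 \<le> kernel_norm M K"
  using kernel_quotient_le_kernel_norm[OF zero_in_L2_0] by (simp add: L2_nrm_alt)

lemma kernel_norm_leI:
  assumes "\<And>f. f \<in> L2_0 M \<Longrightarrow> L2_nrm M (kernel_op K f) / L2_nrm M f \<le> c"
  shows "kernel_norm M K \<le> c"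
  unfolding kernel_norm_def using assms zero_in_L2_0 by (intro cSUP_least) auto

lemma L2_nrm_kernel_op:
  assumes "f \<in> L2_0 M"
  shows "L2_nrm M (kernel_op K f) \<le> kernel_norm M K * L2_nrm M f"
proof (cases "L2_nrm M f = 0")
  \<comment> \<open>The quotient is \<open>0\<close> by convention and carries no information;
    contractivity forces the image to have norm zero too.\<close>
  case True
  then show ?thesis
    using L2_nrm_kernel_op_le[of f] assms by (simp add: L2_0_iff)
next
  case False
  then have "0 < L2_nrm M f"
    using L2_nrm_nonneg[of M f] by linarith
  then show ?thesis
    using kernel_quotient_le_kernel_norm[OF assms] by (simp add: field_simps)
qed

text \<open>Splitting off the means leaves the kernel acting on mean-zero functions only.\<close>

lemma integral_mult_kernel_op_le:
  assumes f: "f \<in> L2 M" and g: "g \<in> L2 M" and c: "kernel_norm M K \<le> c"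
  defines "v \<equiv> \<lambda>h :: 'a \<Rightarrow> real. (\<integral>x. (h x)\<^sup>2 \<partial>M) - (expectation h)\<^sup>2"
  shows "\<bar>\<integral>y. g y * kernel_op K f y \<partial>M\<bar>
    \<le> ((expectation f)\<^sup>2 + (expectation g)\<^sup>2) / 2 + c * ((v f + v g) / 2)"
proof -
  define f0 where "f0 = (\<lambda>x. f x - expectation f)"
  define g0 where "g0 = (\<lambda>x. g x - expectation g)"
  have f0: "f0 \<in> L2_0 M" and g0: "g0 \<in> L2_0 M"
    using f g L2_integrable by (auto simp: f0_def g0_def L2_0_iff L2_diff_const prob_space)
  note Kf = kernel_op_L2[OF f] and Kf0 = kernel_op_L2_0[OF f0]
  \<comment> \<open>Averaging commutes with subtracting a constant where \<open>f\<close> is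
    integrable under \<open>K y\<close>, that is, almost everywhere.\<close>
  have "AE y in M. kernel_op K f0 y = kernel_op K f y - expectation f"
    using AE_integrable[OF L2_integrable[OF f]] AE_space
    by eventually_elim (simp add: kernel_op_def f0_def prob_space.prob_space[OF prob_kernel] integrable_const_K)
  then have "AE y in M. g0 y * kernel_op K f0 y
      = g y * kernel_op K f y - expectation f * g y
        - expectation g * kernel_op K f y + expectation g * expectation f"
    by eventually_elim (simp only: g0_def left_diff_distrib right_diff_distrib, simp)
  then have "(\<integral>y. g0 y * kernel_op K f0 y \<partial>M)
      = (\<integral>y. g y * kernel_op K f y - expectation f * g y
        - expectation g * kernel_op K f y + expectation g * expectation f \<partial>M)"
    using f0 g0 Kf0 Kf g
    by (intro integral_cong_AE) (auto simp: L2_0_iff dest!: L2D(1))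
  also have "\<dots> = (\<integral>y. g y * kernel_op K f y \<partial>M) - expectation f * expectation g
      - expectation g * (\<integral>y. kernel_op K f y \<partial>M) + expectation g * expectation f"
    using integrable_mult_L2[OF g Kf] L2_integrable[OF g] L2_integrable[OF Kf]
    by (simp add: prob_space)
  \<comment> \<open>By invariance the image of \<open>f\<close> has the mean of \<open>f\<close>, so
    the mixed terms collapse to a single product of means.\<close>
  also have "(\<integral>y. kernel_op K f y \<partial>M) = expectation f"
    by (rule integral_kernel_op[OF L2_integrable[OF f]])
  finally have eq: "(\<integral>y. g y * kernel_op K f y \<partial>M)
      = expectation f * expectation g + (\<integral>y. g0 y * kernel_op K f0 y \<partial>M)"
    by simp
  have vf: "(L2_nrm M f0)\<^sup>2 = v f" and vg: "(L2_nrm M g0)\<^sup>2 = v g"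
    using L2_nrm_centered[OF f] L2_nrm_centered[OF g] by (simp_all add: v_def f0_def g0_def)
  have "\<bar>\<integral>y. g0 y * kernel_op K f0 y \<partial>M\<bar> \<le> L2_nrm M g0 * L2_nrm M (kernel_op K f0)"
    using g0 Kf0 by (intro L2_Cauchy_Schwarz) (auto simp: L2_0_iff)
  also have "\<dots> \<le> L2_nrm M g0 * (c * L2_nrm M f0)"
    using L2_nrm_kernel_op[OF f0] mult_right_mono[OF c L2_nrm_nonneg[of M f0]]
    by (intro mult_left_mono L2_nrm_nonneg) linarith
  also have "\<dots> = c * (L2_nrm M f0 * L2_nrm M g0)"
    by simp
  \<comment> \<open>The product of standard deviations is replaced by the average of the variances;
    \<open>c\<close> is nonnegative because it dominates \<open>kernel_norm\<close>.\<close>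
  also have "\<dots> \<le> c * ((v f + v g) / 2)"
    using abs_mult_le_mean_squares[of "L2_nrm M f0" "L2_nrm M g0"] c kernel_norm_nonneg
    unfolding vf[symmetric] vg[symmetric] by (intro mult_left_mono) auto
  finally show ?thesis
    using abs_mult_le_mean_squares[of "expectation f" "expectation g"] unfolding eq by linarith
qed

end

text \<open>Reversibility is tested on a set and the whole space: one side is the mass of the set
  after a step, and the other is its mass before, as each \<open>K y\<close> has total mass
  one.\<close>

lemma (in prob_space) invariant_kernel_reversible:
  assumes K: "K \<in> M \<rightarrow>\<^sub>M prob_algebra M" and rev: "reversible M K"
  shows "invariant_kernel M K"
proof
  show "M \<bind> K = M"
  proof (rule measure_eqI)
    have K': "K \<in> M \<rightarrow>\<^sub>M subprob_algebra M"
      by (rule measurable_prob_algebraD[OF K])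
    show sets: "sets (M \<bind> K) = sets M"
      using sets_bind_measurable[OF K' not_empty] .
    fix A assume "A \<in> sets (M \<bind> K)"
    then have A: "A \<in> sets M"
      by (simp add: sets)
    have 1: "emeasure (K y) (space M) = 1" if "y \<in> space M" for y
    proof -
      have "prob_space (K y)" and "space (K y) = space M"
        using measurable_space[OF K that]
        by (auto simp: space_prob_algebra dest: sets_eq_imp_space_eq)
      then show ?thesis
        by (metis prob_space.emeasure_space_1)
    qed
    have "emeasure (M \<bind> K) A = (\<integral>\<^sup>+y. emeasure (K y) A \<partial>M)"
      by (rule emeasure_bind[OF not_empty K' A])
    also have "\<dots> = (\<integral>\<^sup>+y\<in>space M. emeasure (K y) A \<partial>M)"
      by (intro nn_integral_cong) auto
    also have "\<dots> = (\<integral>\<^sup>+y\<in>A. emeasure (K y) (space M) \<partial>M)"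
      using rev A unfolding reversible_def by auto
    also have "\<dots> = (\<integral>\<^sup>+y. indicator A y \<partial>M)"
      by (intro nn_integral_cong) (simp add: 1)
    finally show "emeasure (M \<bind> K) A = emeasure M A"
      using A by simp
  qed
qed (rule K)

subsection \<open>Data augmentation\<close>

text \<open>The joint law is an equality of measures in both orders, so that integrals against
  \<open>P\<close> unfold by the rules for \<open>\<bind>\<close>. Each marginal carries its own
  sigma-algebra, hence the form \<open>distr P M1 fst = M1\<close>.\<close>

locale data_augmentation = prob_space P
  for P :: "('a \<times> 'b) measure" +
  fixes M1 :: "'a measure" and M2 :: "'b measure"
    and P1 :: "'b \<Rightarrow> 'a measure" and P2 :: "'a \<Rightarrow> 'b measure"
  assumes sets_P: "sets P = sets (M1 \<Otimes>\<^sub>M M2)"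
    and M1: "distr P M1 fst = M1" and M2: "distr P M2 snd = M2"
    and P1: "P1 \<in> M2 \<rightarrow>\<^sub>M prob_algebra M1" and P2: "P2 \<in> M1 \<rightarrow>\<^sub>M prob_algebra M2"
    and disintegration1: "M1 \<bind> (\<lambda>y. distr (P2 y) (M1 \<Otimes>\<^sub>M M2) (\<lambda>z. (y, z))) = P"
    and disintegration2: "M2 \<bind> (\<lambda>z. distr (P1 z) (M1 \<Otimes>\<^sub>M M2) (\<lambda>y. (y, z))) = P"
begin

lemma measurable_P: "h \<in> measurable P N \<longleftrightarrow> h \<in> measurable (M1 \<Otimes>\<^sub>M M2) N"
  using sets_P by (simp cong: measurable_cong_sets)

lemma fst_P: "fst \<in> measurable P M1" and snd_P: "snd \<in> measurable P M2"
  by (auto simp: measurable_P)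

sublocale M1: prob_space M1
  using prob_space_distr[OF fst_P] by (simp add: M1)

sublocale M2: prob_space M2
  using prob_space_distr[OF snd_P] by (simp add: M2)

lemma P1_D: "z \<in> space M2 \<Longrightarrow> prob_space (P1 z)" "z \<in> space M2 \<Longrightarrow> sets (P1 z) = sets M1"
  using measurable_space[OF P1] by (auto simp: space_prob_algebra)

lemma P2_D: "y \<in> space M1 \<Longrightarrow> prob_space (P2 y)" "y \<in> space M1 \<Longrightarrow> sets (P2 y) = sets M2"
  using measurable_space[OF P2] by (auto simp: space_prob_algebra)

lemma joint1: "(\<lambda>y. distr (P2 y) (M1 \<Otimes>\<^sub>M M2) (\<lambda>z. (y, z))) \<in> M1 \<rightarrow>\<^sub>M subprob_algebra (M1 \<Otimes>\<^sub>M M2)"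
  using P2 by (intro measurable_prob_algebraD measurable_distr_prob_space2[where M=M2]) auto

lemma joint2: "(\<lambda>z. distr (P1 z) (M1 \<Otimes>\<^sub>M M2) (\<lambda>y. (y, z))) \<in> M2 \<rightarrow>\<^sub>M subprob_algebra (M1 \<Otimes>\<^sub>M M2)"
  using P1 by (intro measurable_prob_algebraD measurable_distr_prob_space2[where M=M1]) auto

lemma Pair_P2: "y \<in> space M1 \<Longrightarrow> (\<lambda>z. (y, z)) \<in> P2 y \<rightarrow>\<^sub>M M1 \<Otimes>\<^sub>M M2"
  using P2_D[of y] by (auto cong: measurable_cong_sets)

lemma Pair_P1: "z \<in> space M2 \<Longrightarrow> (\<lambda>y. (y, z)) \<in> P1 z \<rightarrow>\<^sub>M M1 \<Otimes>\<^sub>M M2"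
  using P1_D[of z] by (auto cong: measurable_cong_sets)

lemma nn_integral_P1:
  assumes h: "h \<in> borel_measurable (M1 \<Otimes>\<^sub>M M2)"
  shows "(\<integral>\<^sup>+w. h w \<partial>P) = (\<integral>\<^sup>+z. \<integral>\<^sup>+y. h (y, z) \<partial>P1 z \<partial>M2)"
proof -
  have "(\<integral>\<^sup>+w. h w \<partial>P) = (\<integral>\<^sup>+z. \<integral>\<^sup>+w. h w \<partial>distr (P1 z) (M1 \<Otimes>\<^sub>M M2) (\<lambda>y. (y, z)) \<partial>M2)"
    using nn_integral_bind[OF h joint2] by (simp add: disintegration2)
  also have "\<dots> = (\<integral>\<^sup>+z. \<integral>\<^sup>+y. h (y, z) \<partial>P1 z \<partial>M2)"
    using h by (intro nn_integral_cong nn_integral_distr Pair_P1) auto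
  finally show ?thesis .
qed

lemma nn_integral_P2:
  assumes h: "h \<in> borel_measurable (M1 \<Otimes>\<^sub>M M2)"
  shows "(\<integral>\<^sup>+w. h w \<partial>P) = (\<integral>\<^sup>+y. \<integral>\<^sup>+z. h (y, z) \<partial>P2 y \<partial>M1)"
proof -
  have "(\<integral>\<^sup>+w. h w \<partial>P) = (\<integral>\<^sup>+y. \<integral>\<^sup>+w. h w \<partial>distr (P2 y) (M1 \<Otimes>\<^sub>M M2) (\<lambda>z. (y, z)) \<partial>M1)"
    using nn_integral_bind[OF h joint1] by (simp add: disintegration1)
  also have "\<dots> = (\<integral>\<^sup>+y. \<integral>\<^sup>+z. h (y, z) \<partial>P2 y \<partial>M1)"
    using h by (intro nn_integral_cong nn_integral_distr Pair_P2) auto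
  finally show ?thesis .
qed

lemma nn_integral_fst_P:
  "h \<in> borel_measurable M1 \<Longrightarrow> (\<integral>\<^sup>+w. h (fst w) \<partial>P) = (\<integral>\<^sup>+y. h y \<partial>M1)"
  using nn_integral_distr[OF fst_P, of h] by (simp add: M1)

text \<open>One integral over \<open>P\<close> is computed by conditioning on either coordinate;
  equating the results turns statements given \<open>z\<close> into statements given
  \<open>y\<close>.\<close>

lemma
  fixes h :: "'a \<times> 'b \<Rightarrow> real"
  assumes h: "integrable P h"
  shows AE_integrable_P1: "AE z in M2. integrable (P1 z) (\<lambda>y. h (y, z))"
    and integrable_integral_P1: "integrable M2 (\<lambda>z. \<integral>y. h (y, z) \<partial>P1 z)"
    and integral_P1: "(\<integral>w. h w \<partial>P) = (\<integral>z. \<integral>y. h (y, z) \<partial>P1 z \<partial>M2)"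
    and integral_P2: "(\<integral>w. h w \<partial>P) = (\<integral>y. \<integral>z. h (y, z) \<partial>P2 y \<partial>M1)"
proof -
  have meas: "h \<in> borel_measurable (M1 \<Otimes>\<^sub>M M2)"
    using h by (auto simp: measurable_P dest: borel_measurable_integrable)
  have distr1: "(\<integral>w. h w \<partial>distr (P1 z) (M1 \<Otimes>\<^sub>M M2) (\<lambda>y. (y, z))) = (\<integral>y. h (y, z) \<partial>P1 z)"
    if "z \<in> space M2" for z
    using meas by (intro integral_distr Pair_P1 that)
  have distr2: "(\<integral>w. h w \<partial>distr (P2 y) (M1 \<Otimes>\<^sub>M M2) (\<lambda>z. (y, z))) = (\<integral>z. h (y, z) \<partial>P2 y)"
    if "y \<in> space M1" for y
    using meas by (intro integral_distr Pair_P2 that)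
  have int1: "integrable (M2 \<bind> (\<lambda>z. distr (P1 z) (M1 \<Otimes>\<^sub>M M2) (\<lambda>y. (y, z)))) h"
    and int2: "integrable (M1 \<bind> (\<lambda>y. distr (P2 y) (M1 \<Otimes>\<^sub>M M2) (\<lambda>z. (y, z)))) h"
    using h by (simp_all add: disintegration1 disintegration2)
  show "AE z in M2. integrable (P1 z) (\<lambda>y. h (y, z))"
    using AE_integrable_bind[OF joint2 int1 meas] AE_space
    by eventually_elim (use meas in \<open>auto simp: integrable_distr_eq[OF Pair_P1]\<close>)
  show "integrable M2 (\<lambda>z. \<integral>y. h (y, z) \<partial>P1 z)"
    using integrable_integral_bind[OF joint2 int1 meas]
    by (rule Bochner_Integration.integrable_cong[THEN iffD1, rotated -1]) (auto simp: distr1)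
  show "(\<integral>w. h w \<partial>P) = (\<integral>z. \<integral>y. h (y, z) \<partial>P1 z \<partial>M2)"
    using integral_bind_integrable[OF joint2 int1 meas] distr1
    by (simp add: disintegration2 cong: Bochner_Integration.integral_cong)
  show "(\<integral>w. h w \<partial>P) = (\<integral>y. \<integral>z. h (y, z) \<partial>P2 y \<partial>M1)"
    using integral_bind_integrable[OF joint1 int2 meas] distr2
    by (simp add: disintegration1 cong: Bochner_Integration.integral_cong)
qed

lemma integrable_fst_P:
  fixes h :: "'a \<Rightarrow> real"
  assumes h: "h \<in> borel_measurable M1"
  shows "integrable P (\<lambda>w. h (fst w)) \<longleftrightarrow> integrable M1 h"
  using integrable_distr_eq[OF fst_P h] by (simp add: M1)

lemma L2_fst_P: "f \<in> L2 M1 \<Longrightarrow> (\<lambda>w. f (fst w)) \<in> L2 P"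
  using integrable_fst_P[of "\<lambda>x. (f x)\<^sup>2"] by (auto simp: L2_def measurable_P)

lemma measurable_integral_P1:
  fixes h :: "'a \<Rightarrow> real"
  shows "h \<in> borel_measurable M1 \<Longrightarrow> (\<lambda>z. \<integral>y. h y \<partial>P1 z) \<in> borel_measurable M2"
  by (intro measurable_compose[OF measurable_prob_algebraD[OF P1]] integral_measurable_subprob_algebra)

lemma measurable_integral_P2:
  fixes h :: "'a \<times> 'b \<Rightarrow> real"
  assumes h: "h \<in> borel_measurable (M1 \<Otimes>\<^sub>M M2)"
  shows "(\<lambda>y. \<integral>z. h (y, z) \<partial>P2 y) \<in> borel_measurable M1"
proof -
  have "(\<lambda>y. \<integral>w. h w \<partial>distr (P2 y) (M1 \<Otimes>\<^sub>M M2) (\<lambda>z. (y, z))) \<in> borel_measurable M1"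
    by (rule measurable_compose[OF joint1 integral_measurable_subprob_algebra[OF h]])
  then show ?thesis
    by (rule measurable_cong[THEN iffD1, rotated]) (intro integral_distr Pair_P2 h)
qed

lemma AE_L2_P1:
  assumes f: "f \<in> L2 M1"
  shows "AE z in M2. f \<in> L2 (P1 z)"
  using AE_integrable_P1[OF L2D(2)[OF L2_fst_P[OF f]]] AE_space
  by eventually_elim (use P1_D L2D[OF f] in \<open>auto simp: L2_def cong: measurable_cong_sets\<close>)

text \<open>Both sides integrate \<open>w z * (f y)\<^sup>2\<close> over \<open>P\<close>. A weight
  on conditional second moments thus becomes its average over \<open>P2 y\<close>, where the bound
  on powers of \<open>\<gamma>\<close> is available.\<close>

lemma
  fixes w :: "'b \<Rightarrow> real"
  assumes f: "f \<in> L2 M1" and w: "w \<in> borel_measurable M2" "\<And>z. 0 \<le> w z" "\<And>z. w z \<le> 1"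
  shows integrable_weighted_square: "integrable M2 (\<lambda>z. w z * (\<integral>y. (f y)\<^sup>2 \<partial>P1 z))"
    and integral_weighted_square:
      "(\<integral>z. w z * (\<integral>y. (f y)\<^sup>2 \<partial>P1 z) \<partial>M2) = (\<integral>y. (f y)\<^sup>2 * (\<integral>z. w z \<partial>P2 y) \<partial>M1)"
proof -
  have "integrable P (\<lambda>v. (f (fst v))\<^sup>2)"
    using L2D(2)[OF L2_fst_P[OF f]] .
  then have int: "integrable P (\<lambda>v. w (snd v) * (f (fst v))\<^sup>2)"
  proof (rule Bochner_Integration.integrable_bound)
    show "(\<lambda>v. w (snd v) * (f (fst v))\<^sup>2) \<in> borel_measurable P"
      using w(1) L2D(1)[OF f] by (simp add: measurable_P)
    show "AE v in P. norm (w (snd v) * (f (fst v))\<^sup>2) \<le> norm ((f (fst v))\<^sup>2)"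
      using w by (auto simp: abs_mult intro!: mult_left_le_one_le)
  qed
  show "integrable M2 (\<lambda>z. w z * (\<integral>y. (f y)\<^sup>2 \<partial>P1 z))"
    using integrable_integral_P1[OF int] by simp
  show "(\<integral>z. w z * (\<integral>y. (f y)\<^sup>2 \<partial>P1 z) \<partial>M2) = (\<integral>y. (f y)\<^sup>2 * (\<integral>z. w z \<partial>P2 y) \<partial>M1)"
    using integral_P1[OF int] integral_P2[OF int] by (simp add: mult.commute)
qed

lemma integrable_mean_square:
  assumes f: "f \<in> L2 M1"
  shows "integrable M2 (\<lambda>z. (\<integral>y. f y \<partial>P1 z)\<^sup>2)"
proof (rule Bochner_Integration.integrable_bound)
  show "integrable M2 (\<lambda>z. 1 * (\<integral>y. (f y)\<^sup>2 \<partial>P1 z))"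
    using f by (intro integrable_weighted_square) auto
  show "(\<lambda>z. (\<integral>y. f y \<partial>P1 z)\<^sup>2) \<in> borel_measurable M2"
    using measurable_integral_P1[OF L2D(1)[OF f]] by simp
  show "AE z in M2. norm ((\<integral>y. f y \<partial>P1 z)\<^sup>2) \<le> norm (1 * (\<integral>y. (f y)\<^sup>2 \<partial>P1 z))"
    using AE_L2_P1[OF f] AE_space
    by eventually_elim (simp add: prob_space.integral_power2_le[OF P1_D(1)])
qed

end

section \<open>The hybrid kernel and its bilinear form\<close>

locale hybrid_data_augmentation = data_augmentation P M1 M2 P1 P2
  for P :: "('a \<times> 'b) measure" and M1 M2 P1 P2 +
  fixes Q :: "'b \<Rightarrow> 'a \<Rightarrow> 'a measure"
  assumes Q: "(\<lambda>(y, z). Q z y) \<in> M1 \<Otimes>\<^sub>M M2 \<rightarrow>\<^sub>M prob_algebra M1"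
    and Q_invariant: "z \<in> space M2 \<Longrightarrow> invariant_kernel (P1 z) (Q z)"
begin

lemma Q_section: "y \<in> space M1 \<Longrightarrow> (\<lambda>z. Q z y) \<in> M2 \<rightarrow>\<^sub>M prob_algebra M1"
  using measurable_compose[OF measurable_Pair1' Q] by simp

lemma Q_P2: "y \<in> space M1 \<Longrightarrow> (\<lambda>z. Q z y) \<in> P2 y \<rightarrow>\<^sub>M subprob_algebra M1"
  using measurable_prob_algebraD[OF Q_section[of y]] P2_D(2)[of y] by (simp cong: measurable_cong_sets)

lemma Q_D: "y \<in> space M1 \<Longrightarrow> z \<in> space M2 \<Longrightarrow> prob_space (Q z y)"
   "y \<in> space M1 \<Longrightarrow> z \<in> space M2 \<Longrightarrow> sets (Q z y) = sets M1"
  using measurable_space[OF Q, of "(y, z)"] by (auto simp: space_prob_algebra space_pair_measure)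

lemma nn_integral_hybrid_da:
  assumes "y \<in> space M1" and h: "h \<in> borel_measurable M1"
  shows "(\<integral>\<^sup>+x. h x \<partial>hybrid_da P2 Q y) = (\<integral>\<^sup>+z. \<integral>\<^sup>+x. h x \<partial>Q z y \<partial>P2 y)"
  unfolding hybrid_da_def by (rule nn_integral_bind[OF h Q_P2[OF assms(1)]])

lemma measurable_nn_integral_Q:
  assumes "h \<in> borel_measurable M1"
  shows "(\<lambda>w. \<integral>\<^sup>+x. h x \<partial>Q (snd w) (fst w)) \<in> borel_measurable (M1 \<Otimes>\<^sub>M M2)"
  using measurable_compose[OF measurable_prob_algebraD[OF Q] nn_integral_measurable_subprob_algebra[OF assms]]
  by (simp add: split_beta')

lemma measurable_integral_Q:
  fixes h :: "'a \<Rightarrow> real"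
  assumes "h \<in> borel_measurable M1"
  shows "(\<lambda>w. \<integral>x. h x \<partial>Q (snd w) (fst w)) \<in> borel_measurable (M1 \<Otimes>\<^sub>M M2)"
  using measurable_compose[OF measurable_prob_algebraD[OF Q] integral_measurable_subprob_algebra[OF assms]]
  by (simp add: split_beta')

lemma kernel_hybrid_da: "hybrid_da P2 Q \<in> M1 \<rightarrow>\<^sub>M prob_algebra M1"
  unfolding hybrid_da_def by (rule measurable_bind_prob_space2[OF P2 Q])

text \<open>Draw \<open>z\<close>, then \<open>y\<close> given \<open>z\<close>: a step of
  \<open>Q z\<close> preserves \<open>P1 z\<close>, so the new point again has law
  \<open>M1\<close>.\<close>

lemma nn_integral_P_Q:
  assumes h: "h \<in> borel_measurable M1"
  shows "(\<integral>\<^sup>+w. \<integral>\<^sup>+x. h x \<partial>Q (snd w) (fst w) \<partial>P) = (\<integral>\<^sup>+y. h y \<partial>M1)"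
proof -
  have "(\<integral>\<^sup>+w. \<integral>\<^sup>+x. h x \<partial>Q (snd w) (fst w) \<partial>P)
      = (\<integral>\<^sup>+z. \<integral>\<^sup>+y. \<integral>\<^sup>+x. h x \<partial>Q z y \<partial>P1 z \<partial>M2)"
    using nn_integral_P1[OF measurable_nn_integral_Q[OF h]] by simp
  also have "\<dots> = (\<integral>\<^sup>+z. \<integral>\<^sup>+x. h x \<partial>P1 z \<partial>M2)"
  proof (rule nn_integral_cong)
    fix z assume z: "z \<in> space M2"
    interpret Qz: invariant_kernel "P1 z" "Q z"
      by (rule Q_invariant[OF z])
    have "h \<in> borel_measurable (P1 z)"
      using h P1_D(2)[OF z] by (simp cong: measurable_cong_sets)
    then show "(\<integral>\<^sup>+y. \<integral>\<^sup>+x. h x \<partial>Q z y \<partial>P1 z) = (\<integral>\<^sup>+x. h x \<partial>P1 z)"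
      using nn_integral_bind[OF _ measurable_prob_algebraD[OF Qz.kernel], of h]
      by (simp add: Qz.invariant)
  qed
  also have "\<dots> = (\<integral>\<^sup>+w. h (fst w) \<partial>P)"
    using nn_integral_P1[of "\<lambda>w. h (fst w)"] h by simp
  also have "\<dots> = (\<integral>\<^sup>+y. h y \<partial>M1)"
    by (rule nn_integral_fst_P[OF h])
  finally show ?thesis .
qed

text \<open>Drawing \<open>y\<close> first and then \<open>z\<close> from \<open>P2 y\<close>
  rewrites the left side of \<open>nn_integral_P_Q\<close> as one step of the hybrid kernel started
  from \<open>M1\<close>.\<close>

sublocale hybrid: invariant_kernel M1 "hybrid_da P2 Q"
proof
  show "M1 \<bind> hybrid_da P2 Q = M1"
  proof (rule measure_eqI)
    have K: "hybrid_da P2 Q \<in> M1 \<rightarrow>\<^sub>M subprob_algebra M1"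
      by (rule measurable_prob_algebraD[OF kernel_hybrid_da])
    show sets: "sets (M1 \<bind> hybrid_da P2 Q) = sets M1"
      using sets_bind_measurable[OF K M1.not_empty] .
    fix A assume "A \<in> sets (M1 \<bind> hybrid_da P2 Q)"
    then have A: "A \<in> sets M1"
      by (simp add: sets)
    have h: "indicator A \<in> borel_measurable M1"
      using A by simp
    have "emeasure (M1 \<bind> hybrid_da P2 Q) A = (\<integral>\<^sup>+x. indicator A x \<partial>(M1 \<bind> hybrid_da P2 Q))"
      using A by (simp add: sets)
    also have "\<dots> = (\<integral>\<^sup>+y. \<integral>\<^sup>+x. indicator A x \<partial>hybrid_da P2 Q y \<partial>M1)"
      by (rule nn_integral_bind[OF h K])
    also have "\<dots> = (\<integral>\<^sup>+y. \<integral>\<^sup>+z. \<integral>\<^sup>+x. indicator A x \<partial>Q z y \<partial>P2 y \<partial>M1)"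
      by (intro nn_integral_cong nn_integral_hybrid_da h)
    also have "\<dots> = (\<integral>\<^sup>+w. \<integral>\<^sup>+x. indicator A x \<partial>Q (snd w) (fst w) \<partial>P)"
      using nn_integral_P2[OF measurable_nn_integral_Q[OF h]] by simp
    also have "\<dots> = (\<integral>\<^sup>+y. indicator A y \<partial>M1)"
      by (rule nn_integral_P_Q[OF h])
    finally show "emeasure (M1 \<bind> hybrid_da P2 Q) A = emeasure M1 A"
      using A by simp
  qed
qed (rule kernel_hybrid_da)

lemma L2_integral_Q:
  assumes f: "f \<in> L2 M1"
  shows "(\<lambda>w. \<integral>x. f x \<partial>Q (snd w) (fst w)) \<in> L2 P"
proof -
  have meas: "(\<lambda>w. \<integral>x. f x \<partial>Q (snd w) (fst w)) \<in> borel_measurable P"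
    using measurable_integral_Q[OF L2D(1)[OF f]] by (simp add: measurable_P)
  \<comment> \<open>Extended integrals are used because integrability under each
    \<open>Q z y\<close> is not known in advance; the finite bound then yields integrability of the
    square.\<close>
  have "(\<integral>\<^sup>+w. ennreal ((\<integral>x. f x \<partial>Q (snd w) (fst w))\<^sup>2) \<partial>P)
      \<le> (\<integral>\<^sup>+w. \<integral>\<^sup>+x. ennreal ((f x)\<^sup>2) \<partial>Q (snd w) (fst w) \<partial>P)"
  proof (rule nn_integral_mono)
    fix w assume "w \<in> space P"
    then have w: "fst w \<in> space M1" "snd w \<in> space M2"
      using measurable_space[OF fst_P] measurable_space[OF snd_P] by auto
    have "f \<in> borel_measurable (Q (snd w) (fst w))"
      using L2D(1)[OF f] Q_D(2)[OF w] by (simp cong: measurable_cong_sets)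
    then show "ennreal ((\<integral>x. f x \<partial>Q (snd w) (fst w))\<^sup>2)
        \<le> (\<integral>\<^sup>+x. ennreal ((f x)\<^sup>2) \<partial>Q (snd w) (fst w))"
      by (rule prob_space.nn_integral_power2_ge[OF Q_D(1)[OF w]])
  qed
  also have "\<dots> = (\<integral>\<^sup>+y. ennreal ((f y)\<^sup>2) \<partial>M1)"
    using L2D(1)[OF f] by (intro nn_integral_P_Q) auto
  also have "\<dots> < \<infinity>"
    using L2D(2)[OF f] by (simp add: integrable_iff_bounded)
  finally have "integrable P (\<lambda>w. (\<integral>x. f x \<partial>Q (snd w) (fst w))\<^sup>2)"
    using meas by (intro integrableI_nonneg) auto
  then show ?thesis
    using meas by (simp add: L2_def)
qed

text \<open>The integrand is a product of two functions in \<open>L2 P\<close>. Averaging over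
  \<open>z\<close> given \<open>y\<close> produces the hybrid operator; conditioning on
  \<open>z\<close> produces an average of the forms of the kernels \<open>Q z\<close>.\<close>

lemma
  assumes f: "f \<in> L2 M1" and g: "g \<in> L2 M1"
  shows integrable_inner_Q: "integrable M2 (\<lambda>z. \<integral>y. g y * kernel_op (Q z) f y \<partial>P1 z)"
    and integral_mult_hybrid: "(\<integral>y. g y * kernel_op (hybrid_da P2 Q) f y \<partial>M1)
      = (\<integral>z. \<integral>y. g y * kernel_op (Q z) f y \<partial>P1 z \<partial>M2)"
proof -
  have int: "integrable P (\<lambda>w. g (fst w) * (\<integral>x. f x \<partial>Q (snd w) (fst w)))"
    by (rule integrable_mult_L2[OF L2_fst_P[OF g] L2_integral_Q[OF f]])
  show "integrable M2 (\<lambda>z. \<integral>y. g y * kernel_op (Q z) f y \<partial>P1 z)"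
    using integrable_integral_P1[OF int] by (simp add: kernel_op_def)
  have meas: "(\<lambda>y. \<integral>z. \<integral>x. f x \<partial>Q z y \<partial>P2 y) \<in> borel_measurable M1"
    using measurable_integral_P2[OF measurable_integral_Q[OF L2D(1)[OF f]]] by simp
  \<comment> \<open>The operator unfolds where \<open>f\<close> is integrable under the hybrid law
    started at \<open>y\<close>; invariance gives this for almost every \<open>y\<close>.\<close>
  have "AE y in M1. (\<integral>z. \<integral>x. f x \<partial>Q z y \<partial>P2 y) = kernel_op (hybrid_da P2 Q) f y"
    using hybrid.AE_integrable[OF M1.L2_integrable[OF f]] AE_space
  proof eventually_elim
    fix y assume "integrable (hybrid_da P2 Q y) f" and y: "y \<in> space M1"
    then show "(\<integral>z. \<integral>x. f x \<partial>Q z y \<partial>P2 y) = kernel_op (hybrid_da P2 Q) f y"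
      unfolding hybrid_da_def kernel_op_def
      using integral_bind_integrable[OF Q_P2[OF y] _ L2D(1)[OF f]] by simp
  qed
  then have "(\<integral>y. g y * kernel_op (hybrid_da P2 Q) f y \<partial>M1)
      = (\<integral>y. g y * (\<integral>z. \<integral>x. f x \<partial>Q z y \<partial>P2 y) \<partial>M1)"
    using meas L2D(1)[OF g] hybrid.kernel_op_measurable[OF L2D(1)[OF f]]
    by (intro integral_cong_AE) auto
  also have "\<dots> = (\<integral>w. g (fst w) * (\<integral>x. f x \<partial>Q (snd w) (fst w)) \<partial>P)"
    using integral_P2[OF int] by simp
  also have "\<dots> = (\<integral>z. \<integral>y. g y * kernel_op (Q z) f y \<partial>P1 z \<partial>M2)"
    using integral_P1[OF int] by (simp add: kernel_op_def)
  finally show "(\<integral>y. g y * kernel_op (hybrid_da P2 Q) f y \<partial>M1)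
      = (\<integral>z. \<integral>y. g y * kernel_op (Q z) f y \<partial>P1 z \<partial>M2)" .
qed

end

section \<open>The exact kernel as a special hybrid kernel\<close>

lemma exact_da_eq_hybrid_da: "exact_da P2 P1 = hybrid_da P2 (\<lambda>z y. P1 z)"
  by (simp add: fun_eq_iff exact_da_def hybrid_da_def)

context data_augmentation
begin

text \<open>A conditional step that forgets the current state and redraws from \<open>P1 z\<close>
  leaves \<open>P1 z\<close> invariant, so the results on hybrid kernels apply to the exact
  one.\<close>

lemma exact: "hybrid_data_augmentation P M1 M2 P1 P2 (\<lambda>z y. P1 z)"
proof (intro hybrid_data_augmentation.intro data_augmentation_axioms hybrid_data_augmentation_axioms.intro)
  show "(\<lambda>(y, z). P1 z) \<in> M1 \<Otimes>\<^sub>M M2 \<rightarrow>\<^sub>M prob_algebra M1"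
    using measurable_compose[OF measurable_snd P1] by (simp add: split_beta')
next
  fix z assume z: "z \<in> space M2"
  interpret P1z: prob_space "P1 z"
    by (rule P1_D(1)[OF z])
  show "invariant_kernel (P1 z) (\<lambda>y. P1 z)"
  proof
    show "(\<lambda>y. P1 z) \<in> P1 z \<rightarrow>\<^sub>M prob_algebra (P1 z)"
      by (auto simp: space_prob_algebra P1z.prob_space_axioms)
    show "P1 z \<bind> (\<lambda>y. P1 z) = P1 z"
      by (rule bind_const'[OF P1z.prob_space_axioms P1z.subprob_space_axioms])
  qed
qed

text \<open>When \<open>P1 z\<close> is redrawn, the form of \<open>f\<close> with itself given
  \<open>z\<close> factors into the squared conditional mean. The integral is therefore the form of
  the exact kernel, bounded by its norm through Cauchy-Schwarz.\<close>

lemma integral_mean_square_le: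
  assumes f: "f \<in> L2_0 M1" and nrm: "L2_nrm M1 f = 1"
  shows "(\<integral>z. (\<integral>y. f y \<partial>P1 z)\<^sup>2 \<partial>M2) \<le> kernel_norm M1 (exact_da P2 P1)"
proof -
  interpret E: hybrid_data_augmentation P M1 M2 P1 P2 "\<lambda>z y. P1 z"
    by (rule exact)
  note eq = exact_da_eq_hybrid_da[of P2 P1]
  have f': "f \<in> L2 M1"
    using f by (simp add: L2_0_iff)
  have "(\<integral>z. (\<integral>y. f y \<partial>P1 z)\<^sup>2 \<partial>M2) = (\<integral>y. f y * kernel_op (exact_da P2 P1) f y \<partial>M1)"
    using E.integral_mult_hybrid[OF f' f'] by (simp add: eq kernel_op_def power2_eq_square)
  also have "\<dots> \<le> L2_nrm M1 f * L2_nrm M1 (kernel_op (exact_da P2 P1) f)"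
    using L2_Cauchy_Schwarz[OF f' E.hybrid.kernel_op_L2[OF f']] by (simp add: eq)
  also have "\<dots> \<le> kernel_norm M1 (exact_da P2 P1)"
    using E.hybrid.L2_nrm_kernel_op[OF f] by (simp add: eq nrm)
  finally show ?thesis .
qed

end

section \<open>Bounding powers of the hybrid norm\<close>

context hybrid_data_augmentation
begin

text \<open>
  \<open>A\<close> and \<open>V\<close> are the weights of a probability measure carried by the values \<open>1\<close> and \<open>\<gamma>\<close>;
  Jensen's inequality enters through the tangent line of the \<open>t\<close>-th power at \<open>x\<close>.
\<close>

lemma hybrid_form_power_le:
  assumes f: "f \<in> L2_0 M1" "L2_nrm M1 f = 1" and g: "g \<in> L2_0 M1" "L2_nrm M1 g = 1"
    and \<gamma>: "\<gamma> \<in> borel_measurable M2" "\<And>z. 0 \<le> \<gamma> z" "\<And>z. \<gamma> z \<le> 1"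
    and norm_Q: "AE z in M2. kernel_norm (P1 z) (Q z) \<le> \<gamma> z"
    and a: "AE y in M1. (\<integral>z. \<gamma> z ^ t \<partial>P2 y) \<le> a" and t: "0 < t"
  shows "\<bar>\<integral>y. g y * kernel_op (hybrid_da P2 Q) f y \<partial>M1\<bar> ^ t \<le> kernel_norm M1 (exact_da P2 P1) + a"
proof -
  have f': "f \<in> L2 M1" and g': "g \<in> L2 M1"
    using f g by (auto simp: L2_0_iff)
  define b where "b = (\<lambda>z. \<integral>y. g y * kernel_op (Q z) f y \<partial>P1 z)"
  define s where "s = (\<lambda>(h :: 'a \<Rightarrow> real) z. \<integral>y. (h y)\<^sup>2 \<partial>P1 z)"
  define e where "e = (\<lambda>(h :: 'a \<Rightarrow> real) z. (\<integral>y. h y \<partial>P1 z)\<^sup>2)"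
  define A where "A = (\<lambda>z. (e f z + e g z) / 2)"
  define V where "V = (\<lambda>z. ((s f z - e f z) + (s g z - e g z)) / 2)"
  have int_ws: "integrable M2 (\<lambda>z. w z * s h z)"
    if "h \<in> L2 M1" "w \<in> borel_measurable M2" "\<And>z. 0 \<le> w z" "\<And>z. w z \<le> 1" for h and w :: "'b \<Rightarrow> real"
    unfolding s_def by (rule integrable_weighted_square[OF that])
  have int_s: "integrable M2 (s h)" and s_1: "L2_nrm M1 h = 1 \<Longrightarrow> (\<integral>z. s h z \<partial>M2) = 1"
    if "h \<in> L2 M1" for h
  proof -
    show "integrable M2 (s h)"
      using int_ws[OF that, of "\<lambda>_. 1"] by simp
    assume "L2_nrm M1 h = 1"
    then have "(\<integral>y. (h y)\<^sup>2 \<partial>M1) = 1"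
      using L2_nrm_power2[of M1 h] by simp
    moreover have "(\<integral>y. (h y)\<^sup>2 * (\<integral>z. 1 \<partial>P2 y) \<partial>M1) = (\<integral>y. (h y)\<^sup>2 \<partial>M1)"
      by (intro Bochner_Integration.integral_cong refl) (simp add: prob_space.prob_space P2_D(1))
    ultimately show "(\<integral>z. s h z \<partial>M2) = 1"
      using integral_weighted_square[OF that, of "\<lambda>_. 1"] by (simp add: s_def)
  qed
  have int_e: "integrable M2 (e h)" if "h \<in> L2 M1" for h
    unfolding e_def by (rule integrable_mean_square[OF that])
  have se: "AE z in M2. e h z \<le> s h z" if "h \<in> L2 M1" for h
    using AE_L2_P1[OF that] AE_space
    by eventually_elim (simp add: e_def s_def prob_space.integral_power2_le[OF P1_D(1)])
  have e_nonneg: "0 \<le> e h z" for h z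
    by (simp add: e_def)
  have V_nonneg: "AE z in M2. 0 \<le> V z"
    using se[OF f'] se[OF g'] by eventually_elim (simp add: V_def)
  have A_nonneg: "0 \<le> A z" for z
    by (simp add: A_def e_nonneg)
  have int_A: "integrable M2 A" and int_V: "integrable M2 V"
    using int_s[OF f'] int_s[OF g'] int_e[OF f'] int_e[OF g'] by (auto simp: A_def V_def)
  have int_wV: "integrable M2 (\<lambda>z. w z * V z)"
    if "w \<in> borel_measurable M2" "\<And>z. 0 \<le> w z" "\<And>z. w z \<le> 1" for w :: "'b \<Rightarrow> real"
  proof (rule Bochner_Integration.integrable_bound[OF int_V])
    show "(\<lambda>z. w z * V z) \<in> borel_measurable M2"
      using that(1) int_V by auto
    show "AE z in M2. norm (w z * V z) \<le> norm (V z)"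
      using that by (auto simp: abs_mult intro!: mult_left_le_one_le)
  qed
  have one: "(\<integral>z. A z + V z \<partial>M2) = 1"
  proof -
    \<comment> \<open>The squared means cancel, leaving the averaged second moments of two unit
      vectors.\<close>
    have "(\<lambda>z. A z + V z) = (\<lambda>z. (s f z + s g z) / 2)"
      by (auto simp: A_def V_def field_simps)
    then show ?thesis
      using int_s[OF f'] int_s[OF g'] s_1[OF f' f(2)] s_1[OF g' g(2)] by simp
  qed
  \<comment> \<open>\<open>x\<close> is the mean of the values \<open>1\<close> and
    \<open>\<gamma>\<close> under the weights \<open>A\<close> and \<open>V\<close>. It dominates
    the bilinear form and is the point of tangency below.\<close>
  define x where "x = (\<integral>z. A z + \<gamma> z * V z \<partial>M2)"
  have int_x: "integrable M2 (\<lambda>z. A z + \<gamma> z * V z)"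
    using int_A int_wV[OF \<gamma>] by simp
  have b_le: "AE z in M2. \<bar>b z\<bar> \<le> A z + \<gamma> z * V z"
    using norm_Q AE_L2_P1[OF f'] AE_L2_P1[OF g'] AE_space
  proof eventually_elim
    fix z assume z: "kernel_norm (P1 z) (Q z) \<le> \<gamma> z" "f \<in> L2 (P1 z)" "g \<in> L2 (P1 z)" "z \<in> space M2"
    interpret Qz: invariant_kernel "P1 z" "Q z"
      by (rule Q_invariant[OF z(4)])
    show "\<bar>b z\<bar> \<le> A z + \<gamma> z * V z"
      unfolding b_def A_def V_def e_def s_def by (rule Qz.integral_mult_kernel_op_le[OF z(2,3,1)])
  qed
  have int_b: "integrable M2 b"
    unfolding b_def by (rule integrable_inner_Q[OF f' g'])
  have "\<bar>\<integral>z. b z \<partial>M2\<bar> \<le> (\<integral>z. \<bar>b z\<bar> \<partial>M2)"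
    by (rule integral_abs_bound)
  also have "\<dots> \<le> x"
    unfolding x_def using int_b int_x b_le by (intro integral_mono_AE) auto
  finally have form_le: "\<bar>\<integral>y. g y * kernel_op (hybrid_da P2 Q) f y \<partial>M1\<bar> \<le> x"
    using integral_mult_hybrid[OF f' g'] by (simp add: b_def)
  then have x: "0 \<le> x"
    by linarith
  obtain n where n: "t = Suc n"
    using t by (cases t) auto
  have \<gamma>t: "(\<lambda>z. \<gamma> z ^ t) \<in> borel_measurable M2" "\<And>z. 0 \<le> \<gamma> z ^ t" "\<And>z. \<gamma> z ^ t \<le> 1"
    using \<gamma> by (auto intro: power_le_one)
  have int_r: "integrable M2 (\<lambda>z. real t * x ^ n * (A z + \<gamma> z * V z) - real n * x ^ t * (A z + V z))"
    using int_x int_A int_V by auto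
  \<comment> \<open>This is the tangent at \<open>x\<close> evaluated at the mean \<open>x\<close>
    itself; its constant term multiplies the total mass \<open>1\<close>, so the whole becomes one
    integral.\<close>
  have "x ^ t = real t * x ^ n * x - real n * x ^ t * 1"
    by (simp add: n algebra_simps)
  also have "\<dots> = (\<integral>z. real t * x ^ n * (A z + \<gamma> z * V z) - real n * x ^ t * (A z + V z) \<partial>M2)"
    using int_x int_A int_V
    by (subst Bochner_Integration.integral_diff) (simp_all only: x_def[symmetric] one integral_mult_right_zero integrable_mult_right Bochner_Integration.integrable_add)
  also have "\<dots> \<le> (\<integral>z. A z + \<gamma> z ^ t * V z \<partial>M2)"
  proof (rule integral_mono_AE[OF int_r])
    show "integrable M2 (\<lambda>z. A z + \<gamma> z ^ t * V z)"
      using int_A int_wV[OF \<gamma>t] by simp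
    show "AE z in M2. real t * x ^ n * (A z + \<gamma> z * V z) - real n * x ^ t * (A z + V z)
        \<le> A z + \<gamma> z ^ t * V z"
      using V_nonneg
    proof eventually_elim
      fix z assume V: "0 \<le> V z"
      \<comment> \<open>The tangent inequality is used at \<open>1\<close> with weight
        \<open>A z\<close> and at \<open>\<gamma> z\<close> with weight \<open>V z\<close>.\<close>
      have "A z * (real t * x ^ n) \<le> A z * (1 + real n * x ^ t)"
        using power_tangent_le[of 1 x n] x A_nonneg by (intro mult_left_mono) (auto simp: n)
      moreover have "V z * (real t * x ^ n * \<gamma> z) \<le> V z * (\<gamma> z ^ t + real n * x ^ t)"
        using power_tangent_le[OF \<gamma>(2)[of z] x, of n] V unfolding n by (intro mult_left_mono)
      ultimately show "real t * x ^ n * (A z + \<gamma> z * V z) - real n * x ^ t * (A z + V z)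
          \<le> A z + \<gamma> z ^ t * V z"
        by (simp add: algebra_simps)
    qed
  qed
  also have "\<dots> = (\<integral>z. A z \<partial>M2) + (\<integral>z. \<gamma> z ^ t * V z \<partial>M2)"
    using int_A int_wV[OF \<gamma>t] by simp
  also have "(\<integral>z. A z \<partial>M2) \<le> kernel_norm M1 (exact_da P2 P1)"
    using integral_mean_square_le[OF f] integral_mean_square_le[OF g] int_e[OF f'] int_e[OF g']
    by (simp add: A_def e_def)
  also have "(\<integral>z. \<gamma> z ^ t * V z \<partial>M2) \<le> a"
  proof -
    have ws_le: "(\<integral>z. \<gamma> z ^ t * s h z \<partial>M2) \<le> a" if h: "h \<in> L2 M1" "L2_nrm M1 h = 1" for h
    proof -
      have "(\<integral>z. \<gamma> z ^ t * s h z \<partial>M2) = (\<integral>y. (h y)\<^sup>2 * (\<integral>z. \<gamma> z ^ t \<partial>P2 y) \<partial>M1)"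
        unfolding s_def by (rule integral_weighted_square[OF h(1) \<gamma>t])
      also have "\<dots> \<le> (\<integral>y. (h y)\<^sup>2 * a \<partial>M1)"
      proof (rule integral_mono_AE')
        show "integrable M1 (\<lambda>y. (h y)\<^sup>2 * a)"
          using L2D(2)[OF h(1)] by simp
        show "AE y in M1. (h y)\<^sup>2 * (\<integral>z. \<gamma> z ^ t \<partial>P2 y) \<le> (h y)\<^sup>2 * a"
          using a by eventually_elim (auto intro: mult_left_mono)
        \<comment> \<open>Here \<open>a\<close> is nonnegative because it bounds an integral of
          nonnegative powers.\<close>
        show "AE y in M1. 0 \<le> (h y)\<^sup>2 * a"
          using a
        proof eventually_elim
          fix y assume "(\<integral>z. \<gamma> z ^ t \<partial>P2 y) \<le> a"
          moreover have "0 \<le> (\<integral>z. \<gamma> z ^ t \<partial>P2 y)"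
            using \<gamma>t(2) by (rule Bochner_Integration.integral_nonneg)
          ultimately show "0 \<le> (h y)\<^sup>2 * a"
            by simp
        qed
      qed
      also have "\<dots> = a"
        using h(2) L2_nrm_power2[of M1 h] by simp
      finally show ?thesis .
    qed
    \<comment> \<open>Dropping the squared means enlarges \<open>V\<close> to the averaged second
      moments, to which \<open>ws_le\<close> applies.\<close>
    have "(\<integral>z. \<gamma> z ^ t * V z \<partial>M2) \<le> (\<integral>z. (\<gamma> z ^ t * s f z + \<gamma> z ^ t * s g z) / 2 \<partial>M2)"
    proof (rule integral_mono[OF int_wV[OF \<gamma>t]])
      show "integrable M2 (\<lambda>z. (\<gamma> z ^ t * s f z + \<gamma> z ^ t * s g z) / 2)"
        using int_ws[OF f' \<gamma>t] int_ws[OF g' \<gamma>t] by simp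
      fix z
      have "\<gamma> z ^ t * V z \<le> \<gamma> z ^ t * ((s f z + s g z) / 2)"
        using \<gamma>t(2)[of z] e_nonneg[of f z] e_nonneg[of g z] by (intro mult_left_mono) (auto simp: V_def)
      then show "\<gamma> z ^ t * V z \<le> (\<gamma> z ^ t * s f z + \<gamma> z ^ t * s g z) / 2"
        by (simp add: algebra_simps)
    qed
    also have "\<dots> \<le> a"
      using ws_le[OF f' f(2)] ws_le[OF g' g(2)] int_ws[OF f' \<gamma>t] int_ws[OF g' \<gamma>t] by simp
    finally show ?thesis .
  qed
  finally have "x ^ t \<le> kernel_norm M1 (exact_da P2 P1) + a"
    by simp
  moreover have "\<bar>\<integral>y. g y * kernel_op (hybrid_da P2 Q) f y \<partial>M1\<bar> ^ t \<le> x ^ t"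
    using form_le by (intro power_mono) auto
  ultimately show ?thesis
    by linarith
qed

text \<open>With \<open>g\<close> the normalised image of \<open>f\<close>, the bilinear form equals
  the quotient of norms. Bounding each quotient by a \<open>t\<close>-th root allows passage to the
  supremum before the power is taken.\<close>

lemma kernel_norm_hybrid_power_le:
  assumes \<gamma>: "\<gamma> \<in> borel_measurable M2" "\<And>z. 0 \<le> \<gamma> z" "\<And>z. \<gamma> z \<le> 1"
    and norm_Q: "AE z in M2. kernel_norm (P1 z) (Q z) \<le> \<gamma> z"
    and a: "AE y in M1. (\<integral>z. \<gamma> z ^ t \<partial>P2 y) \<le> a" and "0 \<le> a" and t: "0 < t"
  shows "kernel_norm M1 (hybrid_da P2 Q) ^ t \<le> kernel_norm M1 (exact_da P2 P1) + a" (is "?N ^ t \<le> ?c")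
proof -
  interpret E: hybrid_data_augmentation P M1 M2 P1 P2 "\<lambda>z y. P1 z"
    by (rule exact)
  have c: "0 \<le> ?c"
    using E.hybrid.kernel_norm_nonneg \<open>0 \<le> a\<close> by (simp add: exact_da_eq_hybrid_da)
  have "?N \<le> root t ?c"
  proof (rule hybrid.kernel_norm_leI)
    fix f assume f: "f \<in> L2_0 M1"
    define g where "g = kernel_op (hybrid_da P2 Q) f"
    define r q where "r = L2_nrm M1 f" and "q = L2_nrm M1 g"
    have g: "g \<in> L2_0 M1"
      unfolding g_def by (rule hybrid.kernel_op_L2_0[OF f])
    show "L2_nrm M1 (kernel_op (hybrid_da P2 Q) f) / L2_nrm M1 f \<le> root t ?c"
    proof (cases "r = 0 \<or> q = 0")
      case True
      then show ?thesis
        using c t by (auto simp: r_def q_def g_def)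
    next
      case False
      then have r: "0 < r" and q: "0 < q"
        using L2_nrm_nonneg[of M1 f] L2_nrm_nonneg[of M1 g] by (auto simp: r_def q_def)
      define f1 g1 where "f1 = (\<lambda>y. inverse r * f y)" and "g1 = (\<lambda>y. inverse q * g y)"
      have f1: "f1 \<in> L2_0 M1" "L2_nrm M1 f1 = 1" and g1: "g1 \<in> L2_0 M1" "L2_nrm M1 g1 = 1"
        using f g r q by (simp_all add: f1_def g1_def L2_0_iff L2_cmult L2_nrm_cmult flip: r_def q_def)
      \<comment> \<open>Scaling out both normalisations leaves
        \<open>q\<^sup>2 / (q * r)\<close>.\<close>
      have "(\<integral>y. g1 y * kernel_op (hybrid_da P2 Q) f1 y \<partial>M1)
          = (\<integral>y. inverse q * inverse r * (g y)\<^sup>2 \<partial>M1)"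
        by (intro Bochner_Integration.integral_cong refl)
          (simp add: f1_def g1_def g_def kernel_op_def power2_eq_square)
      also have "\<dots> = inverse q * inverse r * q\<^sup>2"
        by (simp add: q_def L2_nrm_power2)
      also have "\<dots> = q / r"
        using q by (simp add: field_simps power2_eq_square)
      finally have "(q / r) ^ t \<le> ?c"
        using hybrid_form_power_le[OF f1 g1 \<gamma> norm_Q a t] q r by simp
      then have "root t ((q / r) ^ t) \<le> root t ?c"
        using t by simp
      then have "q / r \<le> root t ?c"
        using t q r real_root_power_cancel[of t "q / r"] by simp
      then show ?thesis
        by (simp only: q_def r_def g_def)
    qed
  qed
  then have "?N ^ t \<le> root t ?c ^ t"
    by (intro power_mono hybrid.kernel_norm_nonneg)
  then show ?thesis
    using t c by simp
qed

end

section \<open>From conditional distributions to the two inequalities\<close>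

theorem corollary9:
  fixes P :: "('a::polish_space \<times> 'b::polish_space) measure"
    and M1 :: "'a measure" and M2 :: "'b measure"
    and P1 :: "'b \<Rightarrow> 'a measure" and P2 :: "'a \<Rightarrow> 'b measure"
    and Q :: "'b \<Rightarrow> 'a \<Rightarrow> 'a measure"
    and S S_hat :: "'a \<Rightarrow> 'a measure"
    and \<gamma> :: "'b \<Rightarrow> real" and \<alpha> :: "nat \<Rightarrow> real" and t :: nat
  assumes P_prob: "prob_space P"
    and P_sets: "sets P = sets (borel \<Otimes>\<^sub>M borel)"
    and M1_def: "M1 = distr P borel fst"
    and M2_def: "M2 = distr P borel snd"
    and P2: "cond_distr P snd fst P2"
    and P1: "cond_distr P fst snd P1"
    and Q_kernel: "\<And>z. Q z \<in> borel \<rightarrow>\<^sub>M prob_algebra borel"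
    and Q_reversible: "\<And>z. reversible (P1 z) (Q z)"
    and Q_measurable: "\<And>A. A \<in> sets borel \<Longrightarrow>
          (\<lambda>(y, z). measure (Q z y) A) \<in> borel_measurable (borel \<Otimes>\<^sub>M borel)"
    and S_def: "S = exact_da P2 P1"
    and S_hat_def: "S_hat = hybrid_da P2 Q"
    and gamma_measurable: "\<gamma> \<in> borel_measurable borel"
    and gamma_range: "\<And>z. \<gamma> z \<in> {0..1}"
    and gamma_bound: "AE z in M2. kernel_norm (P1 z) (Q z) \<le> \<gamma> z"
    and alpha_range: "\<And>s. s > 0 \<Longrightarrow> \<alpha> s \<in> {0..1}"
    and alpha_bound: "\<And>s. s > 0 \<Longrightarrow> AE y in M1. (\<integral>z. \<gamma> z ^ s \<partial>P2 y) \<le> \<alpha> s"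
    and t_pos: "t > 0"
    and even_or_psd: "even t \<or> (AE z in M2. kernel_psd (P1 z) (Q z))"
  shows "real t * (1 - kernel_norm M1 S_hat) \<ge> 1 - kernel_norm M1 S_hat ^ t
       \<and> 1 - kernel_norm M1 S_hat ^ t \<ge> 1 - kernel_norm M1 S - \<alpha> t"
proof -
  interpret P: prob_space P
    by (rule P_prob)
  have sets_M1[measurable_cong]: "sets M1 = sets borel" and sets_M2[measurable_cong]: "sets M2 = sets borel"
    by (simp_all add: M1_def M2_def)
  have space_P: "space P = UNIV"
    using sets_eq_imp_space_eq[OF P_sets] by (simp add: space_pair_measure)
  have fst_P: "fst \<in> P \<rightarrow>\<^sub>M borel" and snd_P: "snd \<in> P \<rightarrow>\<^sub>M borel"
    using P_sets by (simp_all cong: measurable_cong_sets)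
  have sets12: "sets (M1 \<Otimes>\<^sub>M M2) = sets (borel \<Otimes>\<^sub>M borel)"
    by (intro sets_pair_measure_cong sets_M1 sets_M2)
  have alg: "prob_algebra M1 = prob_algebra borel" "prob_algebra M2 = prob_algebra borel"
    by (rule prob_algebra_cong[OF sets_M1], rule prob_algebra_cong[OF sets_M2])
  have P1_k: "P1 \<in> M2 \<rightarrow>\<^sub>M prob_algebra M1" and P2_k: "P2 \<in> M1 \<rightarrow>\<^sub>M prob_algebra M2"
    using P1 P2 by (auto simp: cond_distr_def alg sets_M1 sets_M2 cong: measurable_cong_sets)
  interpret M1: prob_space M1
    unfolding M1_def by (rule P.prob_space_distr[OF fst_P])
  interpret M2: prob_space M2
    unfolding M2_def by (rule P.prob_space_distr[OF snd_P])
  have P1_prob: "prob_space (P1 z)" and P1_sets: "sets (P1 z) = sets borel" for z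
    using measurable_space[OF P1_k, of z] sets_eq_imp_space_eq[OF sets_M2]
    by (auto simp: space_prob_algebra sets_M1)
  have P2_sets: "sets (P2 y) = sets borel" for y
    using measurable_space[OF P2_k, of y] sets_eq_imp_space_eq[OF sets_M1]
    by (auto simp: space_prob_algebra sets_M2)
  interpret data_augmentation P M1 M2 P1 P2
  proof
    show "sets P = sets (M1 \<Otimes>\<^sub>M M2)"
      by (simp add: P_sets sets12)
    have "distr P M1 fst = distr P borel fst"
      by (rule distr_cong) (simp_all add: sets_M1)
    then show "distr P M1 fst = M1"
      by (simp add: M1_def)
    have "distr P M2 snd = distr P borel snd"
      by (rule distr_cong) (simp_all add: sets_M2)
    then show "distr P M2 snd = M2"
      by (simp add: M2_def)
    have K1: "(\<lambda>y. distr (P2 y) (M1 \<Otimes>\<^sub>M M2) (\<lambda>z. (y, z))) \<in> M1 \<rightarrow>\<^sub>M prob_algebra (M1 \<Otimes>\<^sub>M M2)"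
      using P2_k by (intro measurable_distr_prob_space2[where M=M2]) auto
    have K2: "(\<lambda>z. distr (P1 z) (M1 \<Otimes>\<^sub>M M2) (\<lambda>y. (y, z))) \<in> M2 \<rightarrow>\<^sub>M prob_algebra (M1 \<Otimes>\<^sub>M M2)"
      using P1_k by (intro measurable_distr_prob_space2[where M=M1]) auto
    show "M1 \<bind> (\<lambda>y. distr (P2 y) (M1 \<Otimes>\<^sub>M M2) (\<lambda>z. (y, z))) = P"
    \<comment> \<open>On rectangles the disintegration reduces to the defining identity of
      \<open>cond_distr\<close>.\<close>
    proof (rule prob_space_eqI_rectangles[where A = M1 and B = M2])
      show "prob_space (M1 \<bind> (\<lambda>y. distr (P2 y) (M1 \<Otimes>\<^sub>M M2) (\<lambda>z. (y, z))))"
        by (rule prob_space_bind'[OF _ K1]) (simp add: space_prob_algebra M1.prob_space_axioms)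
      show "sets (M1 \<bind> (\<lambda>y. distr (P2 y) (M1 \<Otimes>\<^sub>M M2) (\<lambda>z. (y, z)))) = sets (M1 \<Otimes>\<^sub>M M2)"
        by (rule sets_bind_measurable[OF measurable_prob_algebraD[OF K1] M1.not_empty])
      fix A B assume AB: "A \<in> sets M1" "B \<in> sets M2"
      have "emeasure (M1 \<bind> (\<lambda>y. distr (P2 y) (M1 \<Otimes>\<^sub>M M2) (\<lambda>z. (y, z)))) (A \<times> B)
          = (\<integral>\<^sup>+y. emeasure (distr (P2 y) (M1 \<Otimes>\<^sub>M M2) (\<lambda>z. (y, z))) (A \<times> B) \<partial>M1)"
        using AB by (intro emeasure_bind[OF M1.not_empty measurable_prob_algebraD[OF K1]]) auto
      also have "\<dots> = (\<integral>\<^sup>+y\<in>A. emeasure (P2 y) B \<partial>M1)"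
      proof (rule nn_integral_cong)
        fix y assume "y \<in> space M1"
        then have "(\<lambda>z. (y, z)) \<in> P2 y \<rightarrow>\<^sub>M M1 \<Otimes>\<^sub>M M2"
          using P2_sets[of y] by (auto simp: sets_M2 cong: measurable_cong_sets)
        moreover have "(\<lambda>z. (y, z)) -` (A \<times> B) \<inter> space (P2 y) = (if y \<in> A then B else {})"
          using sets_eq_imp_space_eq[OF P2_sets] by auto
        ultimately show "emeasure (distr (P2 y) (M1 \<Otimes>\<^sub>M M2) (\<lambda>z. (y, z))) (A \<times> B)
            = emeasure (P2 y) B * indicator A y"
          using AB by (simp add: emeasure_distr)
      qed
      also have "\<dots> = emeasure P {w \<in> space P. fst w \<in> A \<and> snd w \<in> B}"
        using P2 AB by (simp add: cond_distr_def sets_M1 sets_M2 flip: M1_def)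
      also have "{w \<in> space P. fst w \<in> A \<and> snd w \<in> B} = A \<times> B"
        by (auto simp: space_P)
      finally show "emeasure (M1 \<bind> (\<lambda>y. distr (P2 y) (M1 \<Otimes>\<^sub>M M2) (\<lambda>z. (y, z)))) (A \<times> B)
          = emeasure P (A \<times> B)" .
    qed (simp_all add: P_prob P_sets sets12)
    show "M2 \<bind> (\<lambda>z. distr (P1 z) (M1 \<Otimes>\<^sub>M M2) (\<lambda>y. (y, z))) = P"
    proof (rule prob_space_eqI_rectangles[where A = M1 and B = M2])
      show "prob_space (M2 \<bind> (\<lambda>z. distr (P1 z) (M1 \<Otimes>\<^sub>M M2) (\<lambda>y. (y, z))))"
        by (rule prob_space_bind'[OF _ K2]) (simp add: space_prob_algebra M2.prob_space_axioms)
      show "sets (M2 \<bind> (\<lambda>z. distr (P1 z) (M1 \<Otimes>\<^sub>M M2) (\<lambda>y. (y, z)))) = sets (M1 \<Otimes>\<^sub>M M2)"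
        by (rule sets_bind_measurable[OF measurable_prob_algebraD[OF K2] M2.not_empty])
      fix A B assume AB: "A \<in> sets M1" "B \<in> sets M2"
      have "emeasure (M2 \<bind> (\<lambda>z. distr (P1 z) (M1 \<Otimes>\<^sub>M M2) (\<lambda>y. (y, z)))) (A \<times> B)
          = (\<integral>\<^sup>+z. emeasure (distr (P1 z) (M1 \<Otimes>\<^sub>M M2) (\<lambda>y. (y, z))) (A \<times> B) \<partial>M2)"
        using AB by (intro emeasure_bind[OF M2.not_empty measurable_prob_algebraD[OF K2]]) auto
      also have "\<dots> = (\<integral>\<^sup>+z\<in>B. emeasure (P1 z) A \<partial>M2)"
      proof (rule nn_integral_cong)
        fix z assume "z \<in> space M2"
        then have "(\<lambda>y. (y, z)) \<in> P1 z \<rightarrow>\<^sub>M M1 \<Otimes>\<^sub>M M2"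
          using P1_sets[of z] by (auto simp: sets_M1 cong: measurable_cong_sets)
        moreover have "(\<lambda>y. (y, z)) -` (A \<times> B) \<inter> space (P1 z) = (if z \<in> B then A else {})"
          using sets_eq_imp_space_eq[OF P1_sets] by auto
        ultimately show "emeasure (distr (P1 z) (M1 \<Otimes>\<^sub>M M2) (\<lambda>y. (y, z))) (A \<times> B)
            = emeasure (P1 z) A * indicator B z"
          using AB by (simp add: emeasure_distr)
      qed
      \<comment> \<open>Conditioning is now on the second coordinate, so \<open>cond_distr\<close>
        lists the two events in the opposite order.\<close>
      also have "\<dots> = emeasure P {w \<in> space P. snd w \<in> B \<and> fst w \<in> A}"
        using P1 AB by (simp add: cond_distr_def sets_M1 sets_M2 flip: M2_def)
      also have "{w \<in> space P. snd w \<in> B \<and> fst w \<in> A} = A \<times> B"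
        by (auto simp: space_P)
      finally show "emeasure (M2 \<bind> (\<lambda>z. distr (P1 z) (M1 \<Otimes>\<^sub>M M2) (\<lambda>y. (y, z)))) (A \<times> B)
          = emeasure P (A \<times> B)" .
    qed (simp_all add: P_prob P_sets sets12)
  qed (rule P1_k P2_k)+
  interpret hybrid_data_augmentation P M1 M2 P1 P2 Q
  proof (intro hybrid_data_augmentation.intro data_augmentation_axioms hybrid_data_augmentation_axioms.intro)
    have Q_prob: "prob_space (Q z y)" and Q_sets: "sets (Q z y) = sets borel" for z y
      using measurable_space[OF Q_kernel, of y z] by (auto simp: space_prob_algebra)
    have "(\<lambda>(y, z). Q z y) \<in> borel \<Otimes>\<^sub>M borel \<rightarrow>\<^sub>M prob_algebra borel"
    proof (intro measurable_prob_algebraI measurable_subprob_algebra)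
      fix A :: "'a set" assume A: "A \<in> sets borel"
      \<comment> \<open>Measurability is given for the real-valued \<open>measure\<close>; for
        probability measures \<open>emeasure\<close> is its embedding, and setwise measurability
        suffices for a map into \<open>prob_algebra\<close>.\<close>
      have "(\<lambda>w. emeasure (case w of (y, z) \<Rightarrow> Q z y) A)
          = (\<lambda>w. ennreal (case w of (y, z) \<Rightarrow> measure (Q z y) A))"
        using Q_prob
        by (auto simp: fun_eq_iff finite_measure.emeasure_eq_measure prob_space_def split: prod.split)
      then show "(\<lambda>w. emeasure (case w of (y, z) \<Rightarrow> Q z y) A) \<in> borel_measurable (borel \<Otimes>\<^sub>M borel)"
        using Q_measurable[OF A] by simp
    qed (auto simp: Q_sets intro: Q_prob prob_space_imp_subprob_space)
    then show "(\<lambda>(y, z). Q z y) \<in> M1 \<Otimes>\<^sub>M M2 \<rightarrow>\<^sub>M prob_algebra M1"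
      using sets12 by (simp add: alg cong: measurable_cong_sets)
    fix z
    have "prob_algebra (P1 z) = prob_algebra borel"
      by (rule prob_algebra_cong[OF P1_sets])
    then have "Q z \<in> P1 z \<rightarrow>\<^sub>M prob_algebra (P1 z)"
      using Q_kernel[of z] P1_sets[of z] by (simp cong: measurable_cong_sets)
    then show "invariant_kernel (P1 z) (Q z)"
      by (rule prob_space.invariant_kernel_reversible[OF P1_prob _ Q_reversible])
  qed
  have "kernel_norm M1 S_hat ^ t \<le> kernel_norm M1 S + \<alpha> t"
    unfolding S_def S_hat_def
  proof (rule kernel_norm_hybrid_power_le[OF _ _ _ gamma_bound])
    show "\<gamma> \<in> borel_measurable M2"
      using gamma_measurable sets_M2 by (simp cong: measurable_cong_sets)
  qed (use gamma_range alpha_range alpha_bound t_pos in auto)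
  moreover obtain n where "t = Suc n"
    using t_pos by (cases t) auto
  \<comment> \<open>Bernoulli's inequality, from the tangent of the \<open>t\<close>-th power at
    \<open>1\<close>, rearranges to the first of the two claims.\<close>
  then have "real t * kernel_norm M1 S_hat \<le> kernel_norm M1 S_hat ^ t + (real t - 1)"
    using power_tangent_le[of "kernel_norm M1 S_hat" 1 n] hybrid.kernel_norm_nonneg
    by (simp add: S_hat_def)
  ultimately show ?thesis
    by (simp add: algebra_simps)
qed

end
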